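(* The category $\mathbf{LRB}$ of left regular bands is coreflective in the category $\mathbf{SC}$ of supported categories.
   Context: Conventions. Mappings, morphisms and functors are composed from left to right ($fg$ means first $f$, then $g$). For a category $\mathcal C$, $v\mathcal C$ denotes its class of objects and $\mathcal C(c,c')$ the set of morphisms from $c$ to $c'$. A monomorphism is a right cancellable morphism and an epimorphism is a left cancellable morphism. Bands. A left regular band is a semigroup in which every element is idempotent and the identity $efe=ef$ holds. $\mathbf{LRB}$ is the category of left regular bands with all semigroup homomorphisms as morphisms. Coreflectivity. A coreflective subcategory of a category $\mathbf D$ is a full subcategory whose inclusion functor has a right adjoint; a category $\mathbf C$ is coreflective in $\mathbf D$ if $\mathbf C$ is equivalent to a coreflective subcategory of $\mathbf D$. Normal categories. A strict preorder is a category with at most one morphism between any two (possibly equal) objects in which the only isomorphisms are identities. A category with subobjects is a small category $\mathcal C$ with a subcategory $\mathcal P$ such that: $\mathcal P$ is a strict preorder with $v\mathcal P=v\mathcal C$; every $f\in\mathcal P$ is a monomorphism in $\mathcal C$; if $f,g\in\mathcal P$ and $f=hg$ with $h\in\mathcal C$, then $h\in\mathcal P$. Morphisms of $\mathcal P$ are called inclusions; $c\preceq c'$ means $\mathcal P(c,c')\neq\emptyset$, and $j(c,c')$ is then the unique inclusion. An inclusion $j\colon c\to c'$ splits if there is $q\colon c'\to c$ in $\mathcal C$ with $jq=1_c$; such a $q$ is called a retraction. A normal factorisation of a morphism $f$ is $f=quj$ with $q$ a retraction, $u$ an isomorphism, $j$ an inclusion. A cone with vertex $z\in v\mathcal C$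 is a map $\gamma$ assigning to each $c\in v\mathcal C$ a morphism $\gamma(c)\in\mathcal C(c,z)$ such that $j(a,b)\gamma(b)=\gamma(a)$ whenever $a\preceq b$, and $\gamma(c)$ is an isomorphism for at least one $c$; the vertex is denoted $z_\gamma$. $\mathcal C$ is a normal category if it is a category with subobjects in which every inclusion splits, every morphism has a normal factorisation, and for each $c\in v\mathcal C$ there is a cone $\mu$ with vertex $c$ and $\mu(c)=1_c$. In a normal category, for a normal factorisation $f=quj$ the epimorphism $f^\circ:=qu$ does not depend on the factorisation. Semigroup of cones. For a cone $\gamma$ and an epimorphism $f$ with domain $z_\gamma$, $\gamma\ast f$ is the cone $c\mapsto\gamma(c)f$. The set $\widehat{\mathcal C}$ of all cones in a normal category $\mathcal C$ is a regular semigroup under $\gamma\cdot\delta=\gamma\ast(\delta(z_\gamma))^\circ$. Let $\mathscr R$ be Green's relation on $\widehat{\mathcal C}$, $R_\gamma$ the $\mathscr R$-class of $\gamma$; $\widehat{\mathcal C}/\mathscr R$ is partially ordered by $R_\gamma\sqsubseteq R_\delta$ iff the principal right ideal generated by $\gamma$ is contained in that generated by $\delta$. Connected and supported categories. Let $\mathcal C$ be a normal category and $\mathfrak D$ a down-set of $(\widehat{\mathcal C}/\mathscr R,\sqsubseteq)$. An object $c$ is connected by (or to) $\mathfrak d\in\mathfrak D$ if $\mathfrak d$ contains an idempotent cone with vertex $c$; this idempotent cone is then unique and is denoted $\epsilon(c,\mathfrak d)$. $\mathcal C$ is connected by $\mathfrak D$ if every $c\in v\mathcal C$ is connected by some $\mathfrak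 d\in\mathfrak D$; then the pair is denoted $\mathcal C_{\mathfrak D}$ and called a connected category. A connected category is supported if each $c\in v\mathcal C$ is connected by a unique $\mathfrak d\in\mathfrak D$. A CC-morphism from $\mathcal C_{\mathfrak D}$ to $\mathcal C'_{\mathfrak D'}$ is a pair $(F,G)$ where $F\colon\mathcal C\to\mathcal C'$ is an inclusion preserving functor and $G\colon\mathfrak D\to\mathfrak D'$ is an order preserving map such that whenever $c$ is connected to $\mathfrak d$, $F(c)$ is connected to $G(\mathfrak d)$ and $F(\epsilon(c,\mathfrak d)(c'))=\epsilon(F(c),G(\mathfrak d))(F(c'))$ for every $c'\in v\mathcal C$. $\mathbf{CC}$ is the category of connected categories with CC-morphisms, and $\mathbf{SC}$ is its full subcategory of supported categories. *)

theory Defs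
  imports Main "HOL-Library.FuncSet"
begin

section \<open>Categories\<close>

text \<open>Composition is written from left to right: \<open>f \<Zcomp> g\<close> is first \<open>f\<close>, then \<open>g\<close>.\<close>

record ('o, 'm) cat =
  Ob :: "'o set"
  Mor :: "'m set"
  Src :: "'m \<Rightarrow> 'o"
  Tgt :: "'m \<Rightarrow> 'o"
  Idn :: "'o \<Rightarrow> 'm"
  Comp :: "'m \<Rightarrow> 'm \<Rightarrow> 'm"  (infixl "\<Zcomp>\<index>" 70)

definition hom :: "('o, 'm, 'x) cat_scheme \<Rightarrow> 'o \<Rightarrow> 'o \<Rightarrow> 'm set" where
  "hom C a b = {f \<in> Mor C. Src C f = a \<and> Tgt C f = b}"

locale category =
  fixes C :: "('o, 'm, 'x) cat_scheme" (structure)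
  assumes Src_in_Ob: "f \<in> Mor C \<Longrightarrow> Src C f \<in> Ob C"
    and Tgt_in_Ob: "f \<in> Mor C \<Longrightarrow> Tgt C f \<in> Ob C"
    and Idn_in_hom: "a \<in> Ob C \<Longrightarrow> Idn C a \<in> hom C a a"
    and Comp_in_hom: "f \<in> hom C a b \<Longrightarrow> g \<in> hom C b c \<Longrightarrow> f \<Zcomp> g \<in> hom C a c"
    and Comp_assoc: "f \<in> hom C a b \<Longrightarrow> g \<in> hom C b c \<Longrightarrow> h \<in> hom C c d
                      \<Longrightarrow> (f \<Zcomp> g) \<Zcomp> h = f \<Zcomp> (g \<Zcomp> h)"
    and Idn_left: "f \<in> hom C a b \<Longrightarrow> Idn C a \<Zcomp> f = f"
    and Idn_right: "f \<in> hom C a b \<Longrightarrow> f \<Zcomp> Idn C b = f"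

definition monomorphism :: "('o, 'm, 'x) cat_scheme \<Rightarrow> 'm \<Rightarrow> bool" where
  "monomorphism C f \<longleftrightarrow> f \<in> Mor C \<and>
     (\<forall>a. \<forall>g \<in> hom C a (Src C f). \<forall>h \<in> hom C a (Src C f).
        g \<Zcomp>\<^bsub>C\<^esub> f = h \<Zcomp>\<^bsub>C\<^esub> f \<longrightarrow> g = h)"

definition isomorphism :: "('o, 'm, 'x) cat_scheme \<Rightarrow> 'm \<Rightarrow> bool" where
  "isomorphism C f \<longleftrightarrow> f \<in> Mor C \<and>
     (\<exists>g \<in> hom C (Tgt C f) (Src C f).
        f \<Zcomp>\<^bsub>C\<^esub> g = Idn C (Src C f) \<and> g \<Zcomp>\<^bsub>C\<^esub> f = Idn C (Tgt C f))"

definition full_sub :: "('o, 'm, 'x) cat_scheme \<Rightarrow> 'o set \<Rightarrow> ('o, 'm, 'x) cat_scheme" where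
  "full_sub D A = D\<lparr>Ob := A, Mor := {f \<in> Mor D. Src D f \<in> A \<and> Tgt D f \<in> A}\<rparr>"


section \<open>Functors, equivalence, adjunction, coreflectivity\<close>

record ('o, 'm, 'p, 'n) funct =
  omap :: "'o \<Rightarrow> 'p"
  amap :: "'m \<Rightarrow> 'n"

definition is_functor ::
    "('o, 'm, 'x) cat_scheme \<Rightarrow> ('p, 'n, 'y) cat_scheme \<Rightarrow> ('o, 'm, 'p, 'n, 'z) funct_scheme \<Rightarrow> bool"
  where
  "is_functor C D F \<longleftrightarrow> category C \<and> category D \<and>
     (\<forall>a \<in> Ob C. omap F a \<in> Ob D \<and> amap F (Idn C a) = Idn D (omap F a)) \<and>
     (\<forall>a b. \<forall>f \<in> hom C a b. amap F f \<in> hom D (omap F a) (omap F b)) \<and>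
     (\<forall>a b c. \<forall>f \<in> hom C a b. \<forall>g \<in> hom C b c.
        amap F (f \<Zcomp>\<^bsub>C\<^esub> g) = amap F f \<Zcomp>\<^bsub>D\<^esub> amap F g)"

definition id_funct :: "('o, 'm, 'o, 'm) funct" where
  "id_funct = \<lparr>omap = (\<lambda>a. a), amap = (\<lambda>f. f)\<rparr>"

definition comp_funct ::
    "('o, 'm, 'p, 'n) funct \<Rightarrow> ('p, 'n, 'q, 'r) funct \<Rightarrow> ('o, 'm, 'q, 'r) funct" where
  "comp_funct F G =
     \<lparr>omap = (\<lambda>a. omap G (omap F a)), amap = (\<lambda>f. amap G (amap F f))\<rparr>"

definition nat_iso ::
    "('o, 'm, 'x) cat_scheme \<Rightarrow> ('p, 'n, 'y) cat_scheme \<Rightarrow> ('o, 'm, 'p, 'n) funct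
      \<Rightarrow> ('o, 'm, 'p, 'n) funct \<Rightarrow> ('o \<Rightarrow> 'n) \<Rightarrow> bool" where
  "nat_iso C D F G \<tau> \<longleftrightarrow> is_functor C D F \<and> is_functor C D G \<and>
     (\<forall>a \<in> Ob C. \<tau> a \<in> hom D (omap F a) (omap G a) \<and> isomorphism D (\<tau> a)) \<and>
     (\<forall>a b. \<forall>f \<in> hom C a b. amap F f \<Zcomp>\<^bsub>D\<^esub> \<tau> b = \<tau> a \<Zcomp>\<^bsub>D\<^esub> amap G f)"

definition equivalent_cats :: "('o, 'm, 'x) cat_scheme \<Rightarrow> ('p, 'n, 'y) cat_scheme \<Rightarrow> bool" where
  "equivalent_cats C D \<longleftrightarrow>
     (\<exists>F G \<sigma> \<tau>. is_functor C D F \<and> is_functor D C G \<and>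
        nat_iso C C (comp_funct F G) id_funct \<sigma> \<and>
        nat_iso D D (comp_funct G F) id_funct \<tau>)"

definition right_adjoint ::
    "('o, 'm, 'x) cat_scheme \<Rightarrow> ('p, 'n, 'y) cat_scheme
      \<Rightarrow> ('o, 'm, 'p, 'n) funct \<Rightarrow> ('p, 'n, 'o, 'm) funct \<Rightarrow> bool" where
  "right_adjoint A D L R \<longleftrightarrow> is_functor A D L \<and> is_functor D A R \<and>
     (\<exists>\<phi>. (\<forall>a \<in> Ob A. \<forall>d \<in> Ob D.
             bij_betw (\<phi> a d) (hom D (omap L a) d) (hom A a (omap R d))) \<and>
          (\<forall>a \<in> Ob A. \<forall>a' \<in> Ob A. \<forall>d \<in> Ob D. \<forall>d' \<in> Ob D.
             \<forall>h \<in> hom A a' a. \<forall>g \<in> hom D (omap L a) d. \<forall>k \<in> hom D d d'.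
               \<phi> a' d' ((amap L h \<Zcomp>\<^bsub>D\<^esub> g) \<Zcomp>\<^bsub>D\<^esub> k) = (h \<Zcomp>\<^bsub>A\<^esub> \<phi> a d g) \<Zcomp>\<^bsub>A\<^esub> amap R k))"

definition coreflective_subcategory :: "('o, 'm, 'x) cat_scheme \<Rightarrow> 'o set \<Rightarrow> bool" where
  "coreflective_subcategory D A \<longleftrightarrow> category D \<and> A \<subseteq> Ob D \<and>
     (\<exists>R. right_adjoint (full_sub D A) D id_funct R)"

definition coreflective_in :: "('o, 'm, 'x) cat_scheme \<Rightarrow> ('p, 'n, 'y) cat_scheme \<Rightarrow> bool" where
  "coreflective_in C D \<longleftrightarrow>
     (\<exists>A. coreflective_subcategory D A \<and> equivalent_cats C (full_sub D A))"


section \<open>Semigroups, Green's relation R and left regular bands\<close>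

record 'a sgrp =
  elems :: "'a set"
  mult :: "'a \<Rightarrow> 'a \<Rightarrow> 'a"  (infixl "\<cdot>\<index>" 70)

definition semigroup_on :: "('a, 'x) sgrp_scheme \<Rightarrow> bool" where
  "semigroup_on S \<longleftrightarrow>
     (\<forall>x \<in> elems S. \<forall>y \<in> elems S. x \<cdot>\<^bsub>S\<^esub> y \<in> elems S) \<and>
     (\<forall>x \<in> elems S. \<forall>y \<in> elems S. \<forall>z \<in> elems S. (x \<cdot>\<^bsub>S\<^esub> y) \<cdot>\<^bsub>S\<^esub> z = x \<cdot>\<^bsub>S\<^esub> (y \<cdot>\<^bsub>S\<^esub> z))"

definition left_regular_band :: "('a, 'x) sgrp_scheme \<Rightarrow> bool" where
  "left_regular_band S \<longleftrightarrow> semigroup_on S \<and> (\<forall>e \<in> elems S. e \<cdot>\<^bsub>S\<^esub> e = e) \<and>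
     (\<forall>e \<in> elems S. \<forall>f \<in> elems S. (e \<cdot>\<^bsub>S\<^esub> f) \<cdot>\<^bsub>S\<^esub> e = e \<cdot>\<^bsub>S\<^esub> f)"

definition principal_right_ideal :: "('a, 'x) sgrp_scheme \<Rightarrow> 'a \<Rightarrow> 'a set" where
  "principal_right_ideal S a = insert a ((\<lambda>x. a \<cdot>\<^bsub>S\<^esub> x) ` elems S)"

definition green_R :: "('a, 'x) sgrp_scheme \<Rightarrow> ('a \<times> 'a) set" where
  "green_R S = {(a, b). a \<in> elems S \<and> b \<in> elems S \<and>
                        principal_right_ideal S a = principal_right_ideal S b}"

definition R_le :: "('a, 'x) sgrp_scheme \<Rightarrow> 'a set \<Rightarrow> 'a set \<Rightarrow> bool" where
  "R_le S X Y \<longleftrightarrow> X \<in> elems S // green_R S \<and> Y \<in> elems S // green_R S \<and>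
     (\<exists>a \<in> X. \<exists>b \<in> Y. principal_right_ideal S a \<subseteq> principal_right_ideal S b)"

text \<open>Morphisms carry their domain and codomain, and the underlying maps are
  \<open>extensional\<close>, i.e. fixed to be \<open>undefined\<close> outside the domain, so that
  equality of morphisms is equality of maps. The same convention is used for cones and
  for CC-morphisms below. The type of elements plays the role of the universe: \<open>LRB\<close> consists of
  all left regular bands on subsets of it, and likewise for \<open>CC\<close> and \<open>SC\<close>. An infinite type is
  closed, up to bijection, under finite products, so a common infinite type is a suitable
  universe for \<open>LRB\<close> and \<open>SC\<close>.\<close>

type_synonym 'a lrb_cat = "('a sgrp, 'a sgrp \<times> ('a \<Rightarrow> 'a) \<times> 'a sgrp) cat"

definition sgrp_homs :: "'a sgrp \<Rightarrow> 'b sgrp \<Rightarrow> ('a \<Rightarrow> 'b) set" where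
  "sgrp_homs S T = {f \<in> elems S \<rightarrow>\<^sub>E elems T.
     \<forall>x \<in> elems S. \<forall>y \<in> elems S. f (x \<cdot>\<^bsub>S\<^esub> y) = f x \<cdot>\<^bsub>T\<^esub> f y}"

definition LRB :: "'a lrb_cat" where
  "LRB = \<lparr>
     Ob = {S. left_regular_band S},
     Mor = {(S, f, T). left_regular_band S \<and> left_regular_band T \<and> f \<in> sgrp_homs S T},
     Src = (\<lambda>(S, f, T). S),
     Tgt = (\<lambda>(S, f, T). T),
     Idn = (\<lambda>S. (S, \<lambda>x \<in> elems S. x, S)),
     Comp = (\<lambda>(S, f, T) (T', g, U). (S, compose (elems S) g f, U))\<rparr>"


section \<open>Normal categories\<close>

text \<open>Smallness is implicit: objects and morphisms form sets of elements of types. The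
  subcategory of inclusions has all objects, hence it is given by its set of morphisms.\<close>

record ('o, 'm) subobj_cat = "('o, 'm) cat" +
  Inc :: "'m set"

definition strict_preorder :: "('o, 'm, 'x) cat_scheme \<Rightarrow> bool" where
  "strict_preorder P \<longleftrightarrow> category P \<and>
     (\<forall>a b. \<forall>f \<in> hom P a b. \<forall>g \<in> hom P a b. f = g) \<and>
     (\<forall>f. isomorphism P f \<longrightarrow> f = Idn P (Src P f))"

definition category_with_subobjects :: "('o, 'm, 'x) subobj_cat_scheme \<Rightarrow> bool" where
  "category_with_subobjects C \<longleftrightarrow> category C \<and> Inc C \<subseteq> Mor C \<and>
     strict_preorder (C\<lparr>Mor := Inc C\<rparr>) \<and>
     (\<forall>f \<in> Inc C. monomorphism C f) \<and>
     (\<forall>f \<in> Inc C. \<forall>g \<in> Inc C. \<forall>h \<in> Mor C.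
        Tgt C h = Src C g \<and> f = h \<Zcomp>\<^bsub>C\<^esub> g \<longrightarrow> h \<in> Inc C)"

definition retraction_of :: "('o, 'm, 'x) subobj_cat_scheme \<Rightarrow> 'm \<Rightarrow> 'm \<Rightarrow> bool" where
  "retraction_of C j q \<longleftrightarrow> j \<in> Inc C \<and> q \<in> hom C (Tgt C j) (Src C j) \<and>
     j \<Zcomp>\<^bsub>C\<^esub> q = Idn C (Src C j)"

definition normal_factorisation ::
    "('o, 'm, 'x) subobj_cat_scheme \<Rightarrow> 'm \<Rightarrow> 'm \<Rightarrow> 'm \<Rightarrow> 'm \<Rightarrow> bool" where
  "normal_factorisation C f q u j \<longleftrightarrow>
     (\<exists>i. retraction_of C i q) \<and> isomorphism C u \<and> j \<in> Inc C \<and>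
     Tgt C q = Src C u \<and> Tgt C u = Src C j \<and> f = (q \<Zcomp>\<^bsub>C\<^esub> u) \<Zcomp>\<^bsub>C\<^esub> j"

definition epi_part :: "('o, 'm, 'x) subobj_cat_scheme \<Rightarrow> 'm \<Rightarrow> 'm" where
  "epi_part C f = (THE h. \<exists>q u j. normal_factorisation C f q u j \<and> h = q \<Zcomp>\<^bsub>C\<^esub> u)"

definition cone_at :: "('o, 'm, 'x) subobj_cat_scheme \<Rightarrow> 'o \<Rightarrow> ('o \<Rightarrow> 'm) \<Rightarrow> bool" where
  "cone_at C z \<gamma> \<longleftrightarrow> z \<in> Ob C \<and> \<gamma> \<in> (\<Pi>\<^sub>E c \<in> Ob C. hom C c z) \<and>
     (\<forall>j \<in> Inc C. j \<Zcomp>\<^bsub>C\<^esub> \<gamma> (Tgt C j) = \<gamma> (Src C j)) \<and>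
     (\<exists>c \<in> Ob C. isomorphism C (\<gamma> c))"

definition vertex :: "('o, 'm, 'x) subobj_cat_scheme \<Rightarrow> ('o \<Rightarrow> 'm) \<Rightarrow> 'o" where
  "vertex C \<gamma> = (THE z. cone_at C z \<gamma>)"

definition normal_category :: "('o, 'm, 'x) subobj_cat_scheme \<Rightarrow> bool" where
  "normal_category C \<longleftrightarrow> category_with_subobjects C \<and>
     (\<forall>j \<in> Inc C. \<exists>q. retraction_of C j q) \<and>
     (\<forall>f \<in> Mor C. \<exists>q u j. normal_factorisation C f q u j) \<and>
     (\<forall>c \<in> Ob C. \<exists>\<mu>. cone_at C c \<mu> \<and> \<mu> c = Idn C c)"

definition cone_star ::
    "('o, 'm, 'x) subobj_cat_scheme \<Rightarrow> ('o \<Rightarrow> 'm) \<Rightarrow> 'm \<Rightarrow> ('o \<Rightarrow> 'm)" where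
  "cone_star C \<gamma> f = (\<lambda>c \<in> Ob C. \<gamma> c \<Zcomp>\<^bsub>C\<^esub> f)"

definition cones :: "('o, 'm, 'x) subobj_cat_scheme \<Rightarrow> ('o \<Rightarrow> 'm) sgrp" where
  "cones C = \<lparr>
     elems = {\<gamma>. \<exists>z. cone_at C z \<gamma>},
     mult = (\<lambda>\<gamma> \<delta>. cone_star C \<gamma> (epi_part C (\<delta> (vertex C \<gamma>))))\<rparr>"


section \<open>Connected and supported categories\<close>

record ('o, 'm) conn_cat = "('o, 'm) subobj_cat" +
  DSet :: "('o \<Rightarrow> 'm) set set"

definition R_down_set :: "('a, 'x) sgrp_scheme \<Rightarrow> 'a set set \<Rightarrow> bool" where
  "R_down_set S D \<longleftrightarrow> D \<subseteq> elems S // green_R S \<and>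
     (\<forall>Y \<in> D. \<forall>X \<in> elems S // green_R S. R_le S X Y \<longrightarrow> X \<in> D)"

definition idempotent_cone_in ::
    "('o, 'm, 'x) subobj_cat_scheme \<Rightarrow> 'o \<Rightarrow> ('o \<Rightarrow> 'm) set \<Rightarrow> ('o \<Rightarrow> 'm) \<Rightarrow> bool" where
  "idempotent_cone_in C c \<dd> \<epsilon> \<longleftrightarrow> \<epsilon> \<in> \<dd> \<and> cone_at C c \<epsilon> \<and> \<epsilon> \<cdot>\<^bsub>cones C\<^esub> \<epsilon> = \<epsilon>"

definition connected_to ::
    "('o, 'm, 'x) subobj_cat_scheme \<Rightarrow> 'o \<Rightarrow> ('o \<Rightarrow> 'm) set \<Rightarrow> bool" where
  "connected_to C c \<dd> \<longleftrightarrow> (\<exists>\<epsilon>. idempotent_cone_in C c \<dd> \<epsilon>)"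

definition idem_cone ::
    "('o, 'm, 'x) subobj_cat_scheme \<Rightarrow> 'o \<Rightarrow> ('o \<Rightarrow> 'm) set \<Rightarrow> ('o \<Rightarrow> 'm)" where
  "idem_cone C c \<dd> = (THE \<epsilon>. idempotent_cone_in C c \<dd> \<epsilon>)"

definition connected_category :: "('o, 'm, 'x) conn_cat_scheme \<Rightarrow> bool" where
  "connected_category C \<longleftrightarrow> normal_category C \<and> R_down_set (cones C) (DSet C) \<and>
     (\<forall>c \<in> Ob C. \<exists>\<dd> \<in> DSet C. connected_to C c \<dd>)"

definition supported_category :: "('o, 'm, 'x) conn_cat_scheme \<Rightarrow> bool" where
  "supported_category C \<longleftrightarrow> connected_category C \<and>
     (\<forall>c \<in> Ob C. \<exists>!\<dd>. \<dd> \<in> DSet C \<and> connected_to C c \<dd>)"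

record ('o, 'm, 'p, 'n) cc_map = "('o, 'm, 'p, 'n) funct" +
  dmap :: "('o \<Rightarrow> 'm) set \<Rightarrow> ('p \<Rightarrow> 'n) set"

definition cc_homs ::
    "('o, 'm) conn_cat \<Rightarrow> ('p, 'n) conn_cat \<Rightarrow> ('o, 'm, 'p, 'n) cc_map set" where
  "cc_homs C C' = {F.
     is_functor C C' F \<and> amap F ` Inc C \<subseteq> Inc C' \<and>
     omap F \<in> extensional (Ob C) \<and> amap F \<in> extensional (Mor C) \<and>
     dmap F \<in> DSet C \<rightarrow>\<^sub>E DSet C' \<and>
     (\<forall>X \<in> DSet C. \<forall>Y \<in> DSet C.
        R_le (cones C) X Y \<longrightarrow> R_le (cones C') (dmap F X) (dmap F Y)) \<and>
     (\<forall>c \<in> Ob C. \<forall>\<dd> \<in> DSet C. connected_to C c \<dd> \<longrightarrow>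
        connected_to C' (omap F c) (dmap F \<dd>) \<and>
        (\<forall>c' \<in> Ob C. amap F (idem_cone C c \<dd> c') =
                       idem_cone C' (omap F c) (dmap F \<dd>) (omap F c')))}"

type_synonym ('o, 'm) cc_cat =
  "(('o, 'm) conn_cat, ('o, 'm) conn_cat \<times> ('o, 'm, 'o, 'm) cc_map \<times> ('o, 'm) conn_cat) cat"

definition CC :: "('o, 'm) cc_cat" where
  "CC = \<lparr>
     Ob = {C. connected_category C},
     Mor = {(C, F, C'). connected_category C \<and> connected_category C' \<and> F \<in> cc_homs C C'},
     Src = (\<lambda>(C, F, C'). C),
     Tgt = (\<lambda>(C, F, C'). C'),
     Idn = (\<lambda>C. (C, \<lparr>omap = \<lambda>c \<in> Ob C. c, amap = \<lambda>f \<in> Mor C. f, dmap = \<lambda>\<dd> \<in> DSet C. \<dd>\<rparr>, C)),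
     Comp = (\<lambda>(C, F, C') (C1, G, C'').
       (C, \<lparr>omap = compose (Ob C) (omap G) (omap F),
            amap = compose (Mor C) (amap G) (amap F),
            dmap = compose (DSet C) (dmap G) (dmap F)\<rparr>, C''))\<rparr>"

definition SC :: "('o, 'm) cc_cat" where
  "SC = full_sub CC {C. supported_category C}"

end

theory Submission
  imports Defs
begin

text \<open>A supported category has exactly one idempotent cone \<open>\<epsilon>\<^sub>c\<close> in \<open>\<Union>\<DD>\<close> with vertex \<open>c\<close>, for every
  object \<open>c\<close>. These cones are closed under multiplication, with \<open>\<epsilon>\<^sub>y \<epsilon>\<^sub>x = \<epsilon>\<^sub>x\<^sub>y\<close> where \<open>x y\<close> is the
  image of the component \<open>\<epsilon>\<^sub>x(y)\<close>, so the objects form a left regular band. Conversely, a left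
  regular band \<open>B\<close> is the object band of the category of principal left ideals of its opposite.
  A CC-morphism from this category to a supported category is determined by its object map, and the
  object maps that occur are exactly the homomorphisms from \<open>B\<close> to the object band. Hence the
  construction is fully faithful, and the CC-morphism given by the identity of the object band
  is couniversal.\<close>

section \<open>Coreflective subcategories from couniversal arrows\<close>

text \<open>Multiplication of cones is read backwards on objects, so the idempotent cones obey the
  right regular law and the object band the left one; this is why the opposite band enters. Two
  facts make the object map decisive. In the category of a band, every morphism from e to f factors
  as a component of the cone at some u followed by the inclusion of u in f, and a CC-morphism
  preserves both factors. An inclusion preserving functor also preserves split epimorphisms, hence
  images, and products in the object band are images. The object band forgets morphisms that do not
  arise in this way: a group, seen as a category with one object, is supported and has a one-element
  object band, so the couniversal arrow is in general not invertible. Both categories live over one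
  type, while a morphism of the category of a band is a triple of band elements. Triples are
  therefore coded by single elements through an injection \<open>enc\<close>, which an infinite type
  provides.\<close>

lemma hom_Mor: "f \<in> hom C a b \<Longrightarrow> f \<in> Mor C"
  and hom_Src: "f \<in> hom C a b \<Longrightarrow> Src C f = a"
  and hom_Tgt: "f \<in> hom C a b \<Longrightarrow> Tgt C f = b"
  by (simp_all add: hom_def)

lemma Mor_hom: "f \<in> Mor C \<Longrightarrow> f \<in> hom C (Src C f) (Tgt C f)"
  by (simp add: hom_def)

context category
begin

lemma hom_Ob:
  assumes "f \<in> hom C a b"
  shows "a \<in> Ob C" "b \<in> Ob C"
  using assms Src_in_Ob Tgt_in_Ob by (auto simp: hom_def)

lemma inverse_unique:
  assumes "f \<in> hom C a b" "g \<in> hom C b a" "h \<in> hom C b a"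
    and "g \<Zcomp> f = Idn C b" "f \<Zcomp> h = Idn C a"
  shows "g = h"
  using Comp_assoc[OF assms(2,1,3)] Idn_left[OF assms(3)] Idn_right[OF assms(2)] assms(4,5) by simp

end

lemma hom_full_sub: "hom (full_sub D A) a b = (if a \<in> A \<and> b \<in> A then hom D a b else {})"
  by (auto simp: hom_def full_sub_def)

lemma full_sub_simps [simp]:
  "Ob (full_sub D A) = A" "Src (full_sub D A) = Src D" "Tgt (full_sub D A) = Tgt D"
  "Idn (full_sub D A) = Idn D" "Comp (full_sub D A) = Comp D"
  by (simp_all add: full_sub_def)

lemma category_full_sub:
  assumes "category D" "A \<subseteq> Ob D"
  shows "category (full_sub D A)"
proof -
  interpret category D by fact
  show ?thesis
  proof
    fix f g h a b c d
    show "f \<Zcomp>\<^bsub>full_sub D A\<^esub> g \<in> hom (full_sub D A) a c"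
      if "f \<in> hom (full_sub D A) a b" "g \<in> hom (full_sub D A) b c"
      using that by (auto simp: hom_full_sub intro: Comp_in_hom split: if_splits)
    show "(f \<Zcomp>\<^bsub>full_sub D A\<^esub> g) \<Zcomp>\<^bsub>full_sub D A\<^esub> h
        = f \<Zcomp>\<^bsub>full_sub D A\<^esub> (g \<Zcomp>\<^bsub>full_sub D A\<^esub> h)"
      if "f \<in> hom (full_sub D A) a b" "g \<in> hom (full_sub D A) b c" "h \<in> hom (full_sub D A) c d"
      using that by (auto simp: hom_full_sub intro: Comp_assoc split: if_splits)
  qed (use assms(2) Idn_in_hom Idn_left Idn_right in \<open>auto simp: hom_full_sub split: if_splits\<close>,
       auto simp: full_sub_def)
qed

lemma isomorphism_Idn:
  assumes "category D" "a \<in> Ob D"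
  shows "isomorphism D (Idn D a)"
proof -
  interpret category D by fact
  have "Idn D a \<in> hom D a a" by (rule Idn_in_hom) fact
  then show ?thesis
    using Idn_left[of "Idn D a" a a] unfolding isomorphism_def by (auto simp: hom_def)
qed

text \<open>Couniversal arrows \<open>e d\<close> chosen object by object assemble into the right
  adjoint: a morphism k out of d goes to the unique lift of \<open>e d\<close> followed by k.
  Uniqueness of lifts gives functoriality, and \<open>lift\<close> itself is the natural bijection
  of hom sets, inverse to composition with \<open>e d\<close>.\<close>

lemma coreflective_subcategoryI:
  assumes D: "category D" and A: "A \<subseteq> Ob D"
    and "\<And>d. d \<in> Ob D \<Longrightarrow> \<exists>r \<in> A. \<exists>e \<in> hom D r d.
           \<forall>a \<in> A. \<forall>g \<in> hom D a d. \<exists>!k. k \<in> hom D a r \<and> k \<Zcomp>\<^bsub>D\<^esub> e = g"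
  shows "coreflective_subcategory D A"
proof -
  interpret category D by fact
  obtain r e where r: "\<And>d. d \<in> Ob D \<Longrightarrow> r d \<in> A"
    and e: "\<And>d. d \<in> Ob D \<Longrightarrow> e d \<in> hom D (r d) d"
    and u: "\<And>d a g. d \<in> Ob D \<Longrightarrow> a \<in> A \<Longrightarrow> g \<in> hom D a d \<Longrightarrow>
              \<exists>!k. k \<in> hom D a (r d) \<and> k \<Zcomp>\<^bsub>D\<^esub> e d = g"
  proof -
    have "\<exists>r e. r \<in> A \<and> e \<in> hom D r d \<and>
        (\<forall>a \<in> A. \<forall>g \<in> hom D a d. \<exists>!k. k \<in> hom D a r \<and> k \<Zcomp>\<^bsub>D\<^esub> e = g)" if "d \<in> Ob D" for d
      using assms(3)[OF that] by blast
    then obtain r e where "\<And>d. d \<in> Ob D \<Longrightarrow> r d \<in> A \<and> e d \<in> hom D (r d) d \<and>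
        (\<forall>a \<in> A. \<forall>g \<in> hom D a d. \<exists>!k. k \<in> hom D a (r d) \<and> k \<Zcomp>\<^bsub>D\<^esub> e d = g)"
      by metis
    then show thesis using that[of r e] by simp
  qed
  define lift where "lift a d g = (THE k. k \<in> hom D a (r d) \<and> k \<Zcomp>\<^bsub>D\<^esub> e d = g)" for a d g
  have lift: "lift a d g \<in> hom D a (r d)" "lift a d g \<Zcomp>\<^bsub>D\<^esub> e d = g"
    if "a \<in> A" "g \<in> hom D a d" for a d g
    using theI'[OF u[OF hom_Ob(2)[OF that(2)] that]] by (auto simp: lift_def)
  have lift_eq: "lift a d g = k"
    if "a \<in> A" "k \<in> hom D a (r d)" "k \<Zcomp>\<^bsub>D\<^esub> e d = g" "d \<in> Ob D" for a d g k
    unfolding lift_def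
    using that Comp_in_hom[OF that(2) e[OF that(4)]] by (intro the1_equality u) auto
  define R where "R = \<lparr>omap = r, amap = (\<lambda>k. lift (r (Src D k)) (Tgt D k) (e (Src D k) \<Zcomp>\<^bsub>D\<^esub> k))\<rparr>"
  have R_hom: "amap R k \<in> hom D (r d) (r d')" "amap R k \<Zcomp>\<^bsub>D\<^esub> e d' = e d \<Zcomp>\<^bsub>D\<^esub> k"
    if k: "k \<in> hom D d d'" for k d d'
    using lift[OF r, OF hom_Ob(1)[OF k] Comp_in_hom[OF e k], OF hom_Ob(1)[OF k]]
    by (auto simp: R_def hom_Src[OF k] hom_Tgt[OF k])
  have R_eq: "amap R k = l"
    if k: "k \<in> hom D d d'" "l \<in> hom D (r d) (r d')" "l \<Zcomp>\<^bsub>D\<^esub> e d' = e d \<Zcomp>\<^bsub>D\<^esub> k" for k l d d'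
    using lift_eq[OF r that(2,3)] hom_Ob[OF k(1)]
    by (auto simp: R_def hom_Src[OF k(1)] hom_Tgt[OF k(1)])
  have R_functor: "is_functor D (full_sub D A) R"
    unfolding is_functor_def
  proof (intro conjI ballI allI)
    show "category (full_sub D A)" by (rule category_full_sub) fact+
  next
    fix a assume a: "a \<in> Ob D"
    then show "omap R a \<in> Ob (full_sub D A)" using r by (simp add: R_def)
    show "amap R (Idn D a) = Idn (full_sub D A) (omap R a)"
      using R_eq[OF Idn_in_hom[OF a]] Idn_in_hom A r[OF a] e[OF a] Idn_left Idn_right
      by (force simp: R_def)
  next
    fix a b f assume f: "f \<in> hom D a b"
    then show "amap R f \<in> hom (full_sub D A) (omap R a) (omap R b)"
      using R_hom[OF f] r hom_Ob[OF f] by (simp add: R_def hom_full_sub)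
  next
    fix a b c f g assume f: "f \<in> hom D a b" and g: "g \<in> hom D b c"
    have "(amap R f \<Zcomp>\<^bsub>D\<^esub> amap R g) \<Zcomp>\<^bsub>D\<^esub> e c = e a \<Zcomp>\<^bsub>D\<^esub> (f \<Zcomp>\<^bsub>D\<^esub> g)"
    proof -
      note Rf = R_hom[OF f] and Rg = R_hom[OF g]
      note ea = e[OF hom_Ob(1)[OF f]] and eb = e[OF hom_Ob(1)[OF g]] and ec = e[OF hom_Ob(2)[OF g]]
      show ?thesis
        using Comp_assoc[OF Rf(1) Rg(1) ec] Comp_assoc[OF Rf(1) eb g] Comp_assoc[OF ea f g]
        by (simp add: Rf(2) Rg(2))
    qed
    then show "amap R (f \<Zcomp>\<^bsub>D\<^esub> g) = amap R f \<Zcomp>\<^bsub>full_sub D A\<^esub> amap R g"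
      using R_eq[OF Comp_in_hom[OF f g] Comp_in_hom[OF R_hom(1)[OF f] R_hom(1)[OF g]]] by simp
  qed fact
  have id_functor: "is_functor (full_sub D A) D id_funct"
    using A D category_full_sub[OF D A]
    by (auto simp: is_functor_def id_funct_def hom_full_sub split: if_splits)
  have "right_adjoint (full_sub D A) D id_funct R"
    unfolding right_adjoint_def
  proof (intro conjI exI[of _ lift] ballI R_functor id_functor)
    fix a d assume a: "a \<in> Ob (full_sub D A)" and d: "d \<in> Ob D"
    show "bij_betw (lift a d) (hom D (omap id_funct a) d) (hom (full_sub D A) a (omap R d))"
    proof (rule bij_betwI[where g = "\<lambda>k. k \<Zcomp>\<^bsub>D\<^esub> e d"])
    qed (use a d r e lift lift_eq in \<open>auto simp: R_def id_funct_def hom_full_sub intro: Comp_in_hom\<close>)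
  next
    fix a a' d d' h g k
    assume a: "a \<in> Ob (full_sub D A)" "a' \<in> Ob (full_sub D A)" and d: "d \<in> Ob D" "d' \<in> Ob D"
      and h: "h \<in> hom (full_sub D A) a' a" and g: "g \<in> hom D (omap id_funct a) d"
      and k: "k \<in> hom D d d'"
    have h: "h \<in> hom D a' a" and g: "g \<in> hom D a d" and a: "a \<in> A" "a' \<in> A"
      using h g a by (auto simp: hom_full_sub id_funct_def)
    note l = lift[OF a(1) g]
    have l': "(h \<Zcomp>\<^bsub>D\<^esub> lift a d g) \<Zcomp>\<^bsub>D\<^esub> amap R k \<in> hom D a' (r d')"
      using h l R_hom[OF k] by (blast intro: Comp_in_hom)
    have "((h \<Zcomp>\<^bsub>D\<^esub> lift a d g) \<Zcomp>\<^bsub>D\<^esub> amap R k) \<Zcomp>\<^bsub>D\<^esub> e d'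
        = (h \<Zcomp>\<^bsub>D\<^esub> lift a d g) \<Zcomp>\<^bsub>D\<^esub> (amap R k \<Zcomp>\<^bsub>D\<^esub> e d')"
      using Comp_assoc[OF Comp_in_hom[OF h l(1)] R_hom(1)[OF k] e[OF d(2)]] .
    also have "\<dots> = ((h \<Zcomp>\<^bsub>D\<^esub> lift a d g) \<Zcomp>\<^bsub>D\<^esub> e d) \<Zcomp>\<^bsub>D\<^esub> k"
      using Comp_assoc[OF Comp_in_hom[OF h l(1)] e[OF d(1)] k] R_hom(2)[OF k] by simp
    also have "\<dots> = (h \<Zcomp>\<^bsub>D\<^esub> g) \<Zcomp>\<^bsub>D\<^esub> k"
      using Comp_assoc[OF h l(1) e[OF d(1)]] l(2) by simp
    finally show "lift a' d' ((amap id_funct h \<Zcomp>\<^bsub>D\<^esub> g) \<Zcomp>\<^bsub>D\<^esub> k)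
        = (h \<Zcomp>\<^bsub>full_sub D A\<^esub> lift a d g) \<Zcomp>\<^bsub>full_sub D A\<^esub> amap R k"
      using lift_eq[OF a(2) l' _ d(2)] by (simp add: id_funct_def)
  qed
  then show ?thesis
    using D A by (auto simp: coreflective_subcategory_def)
qed

section \<open>Fully faithful functors and their full images\<close>

lemma is_functor_id: "category C \<Longrightarrow> is_functor C C id_funct"
  by (simp add: is_functor_def id_funct_def)

lemma is_functor_comp:
  "is_functor B C F \<Longrightarrow> is_functor C D G \<Longrightarrow> is_functor B D (comp_funct F G)"
  unfolding is_functor_def comp_funct_def by (simp, blast)

text \<open>Fullness gives a preimage of the inverse. Both composites with f have the image of an
  identity, so faithfulness makes them identities.\<close>

lemma fully_faithful_reflects_iso:
  assumes L: "is_functor C D L"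
    and ff: "\<And>a b g. a \<in> Ob C \<Longrightarrow> b \<in> Ob C \<Longrightarrow> g \<in> hom D (omap L a) (omap L b) \<Longrightarrow>
            \<exists>!f. f \<in> hom C a b \<and> amap L f = g"
    and f: "f \<in> hom C a b" and iso: "isomorphism D (amap L f)"
  shows "isomorphism C f"
proof -
  interpret C: category C using L by (simp add: is_functor_def)
  interpret D: category D using L by (simp add: is_functor_def)
  note ab = C.hom_Ob[OF f]
  have Lf: "amap L f \<in> hom D (omap L a) (omap L b)" using L f by (simp add: is_functor_def)
  obtain g where g: "g \<in> hom D (omap L b) (omap L a)"
    "amap L f \<Zcomp>\<^bsub>D\<^esub> g = Idn D (omap L a)" "g \<Zcomp>\<^bsub>D\<^esub> amap L f = Idn D (omap L b)"
    using iso Lf by (auto simp: isomorphism_def hom_Src hom_Tgt)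
  obtain g' where g': "g' \<in> hom C b a" "amap L g' = g" using ff[OF ab(2,1) g(1)] by blast
  have 1: "amap L (f \<Zcomp>\<^bsub>C\<^esub> g') = amap L (Idn C a)" "amap L (g' \<Zcomp>\<^bsub>C\<^esub> f) = amap L (Idn C b)"
    using L f g g' ab unfolding is_functor_def by metis+
  have 2: "amap L (Idn C a) \<in> hom D (omap L a) (omap L a)"
      "amap L (Idn C b) \<in> hom D (omap L b) (omap L b)"
    using L ab C.Idn_in_hom unfolding is_functor_def by blast+
  have "f \<Zcomp>\<^bsub>C\<^esub> g' = Idn C a"
    using ff[OF ab(1) ab(1) 2(1)] 1(1) C.Comp_in_hom[OF f g'(1)] C.Idn_in_hom ab by blast
  moreover have "g' \<Zcomp>\<^bsub>C\<^esub> f = Idn C b"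
    using ff[OF ab(2) ab(2) 2(2)] 1(2) C.Comp_in_hom[OF g'(1) f] C.Idn_in_hom ab by blast
  ultimately show ?thesis
    using f g' by (auto simp: isomorphism_def hom_Src hom_Tgt intro: hom_Mor)
qed

text \<open>The functor L may identify objects, so \<open>G\<close> selects one preimage of each
  object of the image. Going back and forth from the image is then the identity on objects and on
  morphisms, and only the composite on the side of \<open>C\<close> needs a nontrivial
  isomorphism.\<close>

lemma equivalent_full_image:
  fixes L :: "('o, 'm, 'p, 'n) funct"
  assumes L: "is_functor C D L"
    and ff: "\<And>a b g. a \<in> Ob C \<Longrightarrow> b \<in> Ob C \<Longrightarrow> g \<in> hom D (omap L a) (omap L b) \<Longrightarrow>
            \<exists>!f. f \<in> hom C a b \<and> amap L f = g"
  shows "equivalent_cats C (full_sub D (omap L ` Ob C))"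
proof -
  define A where "A = omap L ` Ob C"
  define G where "G = inv_into (Ob C) (omap L)"
  define pre where "pre a b g = (THE f. f \<in> hom C a b \<and> amap L f = g)" for a b g
  interpret C: category C using L by (simp add: is_functor_def)
  interpret D: category D using L by (simp add: is_functor_def)
  have "A \<subseteq> Ob D" using L by (auto simp: is_functor_def A_def)
  then interpret E: category "full_sub D A" by (intro category_full_sub D.category_axioms)
  have G: "G d \<in> Ob C" "omap L (G d) = d" if "d \<in> A" for d
    using that by (simp_all add: A_def G_def inv_into_into f_inv_into_f)
  have L_hom: "amap L f \<in> hom D (omap L a) (omap L b)" if "f \<in> hom C a b" for f a b
    using L that by (simp add: is_functor_def)
  have L_Idn: "amap L (Idn C a) = Idn D (omap L a)" if "a \<in> Ob C" for a
    using L that by (simp add: is_functor_def)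
  have L_Comp: "amap L (f \<Zcomp>\<^bsub>C\<^esub> g) = amap L f \<Zcomp>\<^bsub>D\<^esub> amap L g"
    if "f \<in> hom C a b" "g \<in> hom C b c" for f g a b c
    using L that unfolding is_functor_def by blast
  have pre: "pre a b g \<in> hom C a b" "amap L (pre a b g) = g"
    if "a \<in> Ob C" "b \<in> Ob C" "g \<in> hom D (omap L a) (omap L b)" for a b g
    using theI'[OF ff[OF that]] by (simp_all add: pre_def)
  have faithful: "f = g" if "f \<in> hom C a b" "g \<in> hom C a b" "amap L f = amap L g" for f g a b
    using ff[OF C.hom_Ob[OF that(1)] L_hom[OF that(1)]] that by auto
  define M where "M = \<lparr>omap = G, amap = (\<lambda>g. pre (G (Src D g)) (G (Tgt D g)) g)\<rparr>"
  have M: "amap M g \<in> hom C (G a) (G b)" "amap L (amap M g) = g"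
    if "g \<in> hom D a b" "a \<in> A" "b \<in> A" for g a b
    using pre[OF G(1)[OF that(2)] G(1)[OF that(3)]] that
    by (simp_all add: M_def G hom_Src[OF that(1)] hom_Tgt[OF that(1)])
  have L': "is_functor C (full_sub D A) L"
    using L E.category_axioms C.hom_Ob unfolding is_functor_def
    by (auto simp: hom_full_sub A_def)
  have M': "is_functor (full_sub D A) C M"
    unfolding is_functor_def
  proof (intro conjI ballI allI)
    fix a assume "a \<in> Ob (full_sub D A)"
    then have a: "a \<in> A" by simp
    then show "omap M a \<in> Ob C" by (simp add: M_def G)
    have "Idn D a \<in> hom D a a" using a \<open>A \<subseteq> Ob D\<close> by (blast intro: D.Idn_in_hom)
    then have "amap M (Idn D a) = Idn C (G a)"
      using M[of _ a a] a by (auto intro!: faithful[of _ "G a" "G a"] C.Idn_in_hom simp: G L_Idn)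
    then show "amap M (Idn (full_sub D A) a) = Idn C (omap M a)"
      by (simp add: M_def)
  next
    fix a b f assume "f \<in> hom (full_sub D A) a b"
    then show "amap M f \<in> hom C (omap M a) (omap M b)"
      using M(1)[of f a b] by (simp add: hom_full_sub M_def split: if_splits)
  next
    fix a b c f g assume fg: "f \<in> hom (full_sub D A) a b" "g \<in> hom (full_sub D A) b c"
    then have f: "f \<in> hom D a b" and g: "g \<in> hom D b c" and abc: "a \<in> A" "b \<in> A" "c \<in> A"
      by (auto simp: hom_full_sub split: if_splits)
    have "amap L (amap M f \<Zcomp>\<^bsub>C\<^esub> amap M g) = f \<Zcomp>\<^bsub>D\<^esub> g"
      using L_Comp[OF M(1)[OF f] M(1)[OF g]] M(2) f g abc by simp
    then show "amap M (f \<Zcomp>\<^bsub>full_sub D A\<^esub> g) = amap M f \<Zcomp>\<^bsub>C\<^esub> amap M g"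
      using faithful[OF M(1)[OF D.Comp_in_hom[OF f g]] C.Comp_in_hom[OF M(1)[OF f] M(1)[OF g]]]
        M(2)[OF D.Comp_in_hom[OF f g]] abc by simp
  qed (unfold_locales)
  \<comment> \<open>The objects \<open>G (omap L a)\<close> and \<open>a\<close> have the same
    image, so the identity of that image lifts to a morphism between them; it is invertible because
    fully faithful functors reflect isomorphisms.\<close>
  define \<sigma> where "\<sigma> a = pre (G (omap L a)) a (Idn D (omap L a))" for a
  have \<sigma>: "\<sigma> a \<in> hom C (G (omap L a)) a" "amap L (\<sigma> a) = Idn D (omap L a)" if "a \<in> Ob C" for a
  proof -
    have "omap L a \<in> A" using that by (simp add: A_def)
    then have "Idn D (omap L a) \<in> hom D (omap L (G (omap L a))) (omap L a)"
      using \<open>A \<subseteq> Ob D\<close> D.Idn_in_hom G by auto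
    then show "\<sigma> a \<in> hom C (G (omap L a)) a" "amap L (\<sigma> a) = Idn D (omap L a)"
      using pre[OF G(1) that] \<open>omap L a \<in> A\<close> by (simp_all add: \<sigma>_def)
  qed
  have LA: "omap L a \<in> A" if "a \<in> Ob C" for a using that by (simp add: A_def)
  have "nat_iso C C (comp_funct L M) id_funct \<sigma>"
    unfolding nat_iso_def
  proof (intro conjI ballI allI)
    show "is_functor C C (comp_funct L M)" using L' M' by (rule is_functor_comp)
    show "is_functor C C id_funct" by (rule is_functor_id) unfold_locales
  next
    fix a assume a: "a \<in> Ob C"
    then show "\<sigma> a \<in> hom C (omap (comp_funct L M) a) (omap id_funct a)"
      using \<sigma> by (simp add: comp_funct_def id_funct_def M_def)
    show "isomorphism C (\<sigma> a)"
      using fully_faithful_reflects_iso[OF L ff \<sigma>(1)[OF a]] \<sigma>(2)[OF a]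
        isomorphism_Idn[OF D.category_axioms] LA[OF a] \<open>A \<subseteq> Ob D\<close> by auto
  next
    fix a b f assume f: "f \<in> hom C a b"
    note ab = C.hom_Ob[OF f]
    note Mf = M[OF L_hom[OF f] LA LA, OF ab]
    have "amap L (amap M (amap L f) \<Zcomp>\<^bsub>C\<^esub> \<sigma> b) = amap L f"
      using L_Comp[OF Mf(1) \<sigma>(1)[OF ab(2)]] Mf \<sigma>(2)[OF ab(2)] D.Idn_right[OF L_hom[OF f]] by simp
    moreover have "amap L (\<sigma> a \<Zcomp>\<^bsub>C\<^esub> f) = amap L f"
      using L_Comp[OF \<sigma>(1)[OF ab(1)] f] \<sigma>(2)[OF ab(1)] D.Idn_left[OF L_hom[OF f]] by simp
    ultimately have "amap M (amap L f) \<Zcomp>\<^bsub>C\<^esub> \<sigma> b = \<sigma> a \<Zcomp>\<^bsub>C\<^esub> f"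
      using faithful C.Comp_in_hom[OF Mf(1) \<sigma>(1)[OF ab(2)]] C.Comp_in_hom[OF \<sigma>(1)[OF ab(1)] f]
      by metis
    then show "amap (comp_funct L M) f \<Zcomp>\<^bsub>C\<^esub> \<sigma> b = \<sigma> a \<Zcomp>\<^bsub>C\<^esub> amap id_funct f"
      by (simp add: comp_funct_def id_funct_def)
  qed
  moreover have "nat_iso (full_sub D A) (full_sub D A) (comp_funct M L) id_funct (Idn D)"
    unfolding nat_iso_def
  proof (intro conjI ballI allI)
    show "is_functor (full_sub D A) (full_sub D A) (comp_funct M L)"
      using M' L' by (rule is_functor_comp)
    show "is_functor (full_sub D A) (full_sub D A) id_funct" by (rule is_functor_id) unfold_locales
  next
    fix a assume "a \<in> Ob (full_sub D A)"
    then show "Idn D a \<in> hom (full_sub D A) (omap (comp_funct M L) a) (omap id_funct a)"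
      and "isomorphism (full_sub D A) (Idn D a)"
      using E.Idn_in_hom isomorphism_Idn[OF E.category_axioms]
      by (auto simp: comp_funct_def id_funct_def M_def G)
  next
    fix a b f assume f: "f \<in> hom (full_sub D A) a b"
    then have f': "f \<in> hom D a b" "a \<in> A" "b \<in> A" by (auto simp: hom_full_sub split: if_splits)
    then show "amap (comp_funct M L) f \<Zcomp>\<^bsub>full_sub D A\<^esub> Idn D b
        = Idn D a \<Zcomp>\<^bsub>full_sub D A\<^esub> amap id_funct f"
      using M(2)[OF f'] D.Idn_left D.Idn_right by (simp add: comp_funct_def id_funct_def)
  qed
  ultimately show ?thesis
    using L' M' unfolding equivalent_cats_def A_def by blast
qed


section \<open>Green's relation\<close>

lemma mult_idempotent_right_ideal:
  assumes "semigroup_on S" "y \<in> elems S" "y \<cdot>\<^bsub>S\<^esub> y = y" "x \<in> principal_right_ideal S y"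
  shows "y \<cdot>\<^bsub>S\<^esub> x = x"
  using assms unfolding semigroup_on_def principal_right_ideal_def by (elim insertE imageE; metis)

lemma principal_right_ideal_mono:
  assumes "semigroup_on S" "x \<in> elems S" "y \<in> elems S" "x \<in> principal_right_ideal S y"
  shows "principal_right_ideal S x \<subseteq> principal_right_ideal S y"
  using assms unfolding semigroup_on_def principal_right_ideal_def by (auto intro: image_eqI)

lemma equiv_green_R: "equiv (elems S) (green_R S)"
  unfolding equiv_def refl_on_def sym_def trans_def green_R_def by auto

text \<open>An idempotent is a left identity of the right ideal it generates, so containment of
  right ideals between idempotents reduces to the single equation
  \<open>y \<cdot> x = x\<close>.\<close>

lemma green_R_iff_idempotents:
  assumes "semigroup_on S" "x \<in> elems S" "y \<in> elems S" "x \<cdot>\<^bsub>S\<^esub> x = x" "y \<cdot>\<^bsub>S\<^esub> y = y"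
  shows "(x, y) \<in> green_R S \<longleftrightarrow> y \<cdot>\<^bsub>S\<^esub> x = x \<and> x \<cdot>\<^bsub>S\<^esub> y = y"
proof -
  have *: "principal_right_ideal S x \<subseteq> principal_right_ideal S y \<longleftrightarrow> y \<cdot>\<^bsub>S\<^esub> x = x"
    if "x \<in> elems S" "y \<in> elems S" "y \<cdot>\<^bsub>S\<^esub> y = y" for x y
  proof
    assume "principal_right_ideal S x \<subseteq> principal_right_ideal S y"
    then have "x \<in> principal_right_ideal S y" by (auto simp: principal_right_ideal_def)
    then show "y \<cdot>\<^bsub>S\<^esub> x = x" using mult_idempotent_right_ideal[OF assms(1)] that by blast
  next
    assume "y \<cdot>\<^bsub>S\<^esub> x = x"
    then have "x \<in> principal_right_ideal S y"
      using that unfolding principal_right_ideal_def by (metis imageI insertI2)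
    then show "principal_right_ideal S x \<subseteq> principal_right_ideal S y"
      using principal_right_ideal_mono[OF assms(1)] that by blast
  qed
  show ?thesis
    using *[of x y] *[of y x] assms by (auto simp: green_R_def)
qed

lemma R_le_class_idempotents:
  assumes S: "semigroup_on S" and x: "x \<in> elems S" "x \<cdot>\<^bsub>S\<^esub> x = x" and y: "y \<in> elems S" "y \<cdot>\<^bsub>S\<^esub> y = y"
  shows "R_le S (green_R S `` {x}) (green_R S `` {y}) \<longleftrightarrow> y \<cdot>\<^bsub>S\<^esub> x = x"
proof
  assume "R_le S (green_R S `` {x}) (green_R S `` {y})"
  then have "principal_right_ideal S x \<subseteq> principal_right_ideal S y"
    by (auto simp: R_le_def green_R_def)
  then have "x \<in> principal_right_ideal S y" by (auto simp: principal_right_ideal_def)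
  then show "y \<cdot>\<^bsub>S\<^esub> x = x" using mult_idempotent_right_ideal[OF S] y by blast
next
  assume "y \<cdot>\<^bsub>S\<^esub> x = x"
  then have "x \<in> principal_right_ideal S y"
    using x unfolding principal_right_ideal_def by (metis imageI insertI2)
  then have "principal_right_ideal S x \<subseteq> principal_right_ideal S y"
    using principal_right_ideal_mono[OF S] x y by blast
  moreover have "x \<in> green_R S `` {x}" "y \<in> green_R S `` {y}"
    using x y by (auto simp: green_R_def)
  ultimately show "R_le S (green_R S `` {x}) (green_R S `` {y})"
    using x y unfolding R_le_def by (blast intro: quotientI)
qed


section \<open>Normal categories\<close>

context category
begin

lemma comp_simps:
  assumes "f \<in> Mor C" "g \<in> Mor C" "Tgt C f = Src C g"
  shows "f \<Zcomp> g \<in> Mor C" "Src C (f \<Zcomp> g) = Src C f" "Tgt C (f \<Zcomp> g) = Tgt C g"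
  using Comp_in_hom[of f "Src C f" "Src C g" g "Tgt C g"] assms by (simp_all add: hom_def)

lemma comp_assoc:
  assumes "f \<in> Mor C" "g \<in> Mor C" "h \<in> Mor C" "Tgt C f = Src C g" "Tgt C g = Src C h"
  shows "(f \<Zcomp> g) \<Zcomp> h = f \<Zcomp> (g \<Zcomp> h)"
  using Comp_assoc[of f "Src C f" "Src C g" g "Src C h" h "Tgt C h"] assms by (simp add: hom_def)

lemma Idn_simps:
  assumes "a \<in> Ob C"
  shows "Idn C a \<in> Mor C" "Src C (Idn C a) = a" "Tgt C (Idn C a) = a"
  using Idn_in_hom[OF assms] by (simp_all add: hom_def)

lemma Idn_comp:
  assumes "f \<in> Mor C"
  shows "Src C f = a \<Longrightarrow> Idn C a \<Zcomp> f = f" "Tgt C f = b \<Longrightarrow> f \<Zcomp> Idn C b = f"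
  using Idn_left Idn_right assms by (auto simp: hom_def)

lemmas cat_simps = comp_simps comp_assoc Idn_simps Idn_comp Src_in_Ob Tgt_in_Ob

lemma isoI:
  assumes "f \<in> hom C a b" "g \<in> hom C b a" "f \<Zcomp> g = Idn C a" "g \<Zcomp> f = Idn C b"
  shows "isomorphism C f"
  using assms by (auto simp: isomorphism_def hom_def)

lemma isoE:
  assumes "isomorphism C f" "f \<in> hom C a b"
  obtains g where "g \<in> hom C b a" "f \<Zcomp> g = Idn C a" "g \<Zcomp> f = Idn C b"
  using assms by (auto simp: isomorphism_def hom_def)

end

section \<open>Inclusions, split epimorphisms and images in a normal category\<close>

definition incl :: "('o, 'm, 'x) subobj_cat_scheme \<Rightarrow> 'o \<Rightarrow> 'o \<Rightarrow> 'm set" where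
  "incl C a b = hom C a b \<inter> Inc C"

text \<open>In a normal category these are exactly the composites of a retraction with an
  isomorphism, hence the possible epimorphic parts. The splitting condition is easier to handle: it
  is visibly closed under composition and preserved by functors.\<close>

definition split_epis :: "('o, 'm, 'x) cat_scheme \<Rightarrow> 'o \<Rightarrow> 'o \<Rightarrow> 'm set" where
  "split_epis C a b = {f \<in> hom C a b. \<exists>s \<in> hom C b a. s \<Zcomp>\<^bsub>C\<^esub> f = Idn C b}"

definition img :: "('o, 'm, 'x) subobj_cat_scheme \<Rightarrow> 'm \<Rightarrow> 'o" where
  "img C f = Tgt C (epi_part C f)"

lemma incl_hom: "j \<in> incl C a b \<Longrightarrow> j \<in> hom C a b"
  by (simp add: incl_def)

lemma split_epis_hom: "f \<in> split_epis C a b \<Longrightarrow> f \<in> hom C a b"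
  by (simp add: split_epis_def)

locale normal_cat =
  fixes C :: "('o, 'm, 'x) subobj_cat_scheme" (structure)
  assumes normal: "normal_category C"
begin

lemma with_subobjects: "category_with_subobjects C"
  using normal by (simp add: normal_category_def)

sublocale category C
  using with_subobjects by (simp add: category_with_subobjects_def)

lemma Inc_incl: "j \<in> Inc C \<Longrightarrow> j \<in> incl C (Src C j) (Tgt C j)"
  using with_subobjects by (auto simp: category_with_subobjects_def incl_def hom_def)

lemma hom_inclusions: "hom (C\<lparr>Mor := Inc C\<rparr>) a b = incl C a b"
  using with_subobjects by (auto simp: category_with_subobjects_def incl_def hom_def)

lemma preorder: "strict_preorder (C\<lparr>Mor := Inc C\<rparr>)"
  using with_subobjects by (simp add: category_with_subobjects_def)

lemma incl_unique:
  assumes "j \<in> incl C a b" "k \<in> incl C a b"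
  shows "j = k"
  using preorder assms unfolding strict_preorder_def hom_inclusions by blast

lemma incl_Idn: "a \<in> Ob C \<Longrightarrow> Idn C a \<in> incl C a a"
  using category.Idn_in_hom[of "C\<lparr>Mor := Inc C\<rparr>" a] preorder
  by (simp add: strict_preorder_def hom_inclusions)

lemma incl_comp:
  assumes "j \<in> incl C a b" "k \<in> incl C b c"
  shows "j \<Zcomp> k \<in> incl C a c"
  using category.Comp_in_hom[of "C\<lparr>Mor := Inc C\<rparr>" j a b k c] preorder assms
  by (simp add: strict_preorder_def hom_inclusions)

lemma incl_mono:
  assumes "j \<in> incl C b c" "g \<in> hom C a b" "h \<in> hom C a b" "g \<Zcomp> j = h \<Zcomp> j"
  shows "g = h"
proof -
  have "monomorphism C j"
    using with_subobjects assms(1) by (auto simp: category_with_subobjects_def incl_def)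
  then show ?thesis
    using assms hom_Src[OF incl_hom[OF assms(1)]] unfolding monomorphism_def by blast
qed

lemma incl_divide:
  assumes "f \<in> incl C a c" "g \<in> incl C b c" "h \<in> hom C a b" "f = h \<Zcomp> g"
  shows "h \<in> incl C a b"
proof -
  have "Tgt C h = Src C g" using assms(2,3) by (simp add: incl_def hom_def)
  then have "h \<in> Inc C"
    using with_subobjects assms unfolding category_with_subobjects_def incl_def hom_def by blast
  then show ?thesis using assms(3) by (simp add: incl_def)
qed

lemma incl_antisym:
  assumes j: "j \<in> incl C a b" and k: "k \<in> incl C b a"
  shows "a = b"
proof -
  have "j \<Zcomp> k = Idn C a" "k \<Zcomp> j = Idn C b"
    using incl_unique incl_comp[OF j k] incl_comp[OF k j] incl_Idn hom_Ob[OF incl_hom[OF j]] by blast+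
  then have "isomorphism (C\<lparr>Mor := Inc C\<rparr>) j"
    using j k by (auto simp: isomorphism_def hom_inclusions incl_def hom_def)
  then have "j = Idn C a"
    using preorder hom_Src[OF incl_hom[OF j]] by (auto simp: strict_preorder_def)
  then show ?thesis
    using hom_Tgt[OF incl_hom[OF j]] Idn_simps(3) hom_Ob(1)[OF incl_hom[OF j]] by simp
qed

lemma split_epis_Idn: "a \<in> Ob C \<Longrightarrow> Idn C a \<in> split_epis C a a"
  unfolding split_epis_def using Idn_in_hom Idn_left by blast

lemma split_epis_comp:
  assumes f: "f \<in> split_epis C a b" and g: "g \<in> split_epis C b c"
  shows "f \<Zcomp> g \<in> split_epis C a c"
proof -
  obtain s t where st: "s \<in> hom C b a" "s \<Zcomp> f = Idn C b" "t \<in> hom C c b" "t \<Zcomp> g = Idn C c"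
    using f g by (auto simp: split_epis_def)
  have "(t \<Zcomp> s) \<Zcomp> (f \<Zcomp> g) = t \<Zcomp> ((s \<Zcomp> f) \<Zcomp> g)"
    using st(1,3) split_epis_hom[OF f] split_epis_hom[OF g] by (simp add: hom_def cat_simps)
  also have "\<dots> = Idn C c"
    using st split_epis_hom[OF g] by (simp add: hom_def cat_simps)
  finally show ?thesis
    unfolding split_epis_def
    using split_epis_hom[OF f] split_epis_hom[OF g] st(1,3) Comp_in_hom by blast
qed

lemma iso_split_epi:
  assumes "f \<in> hom C a b" "g \<in> hom C b a" "g \<Zcomp> f = Idn C b"
  shows "f \<in> split_epis C a b"
  using assms by (auto simp: split_epis_def)

lemma normal_factorisation_split_epi:
  assumes "normal_factorisation C f q u j"
  shows "q \<Zcomp> u \<in> split_epis C (Src C q) (Src C j)" "j \<in> incl C (Src C j) (Tgt C j)"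
    "f = (q \<Zcomp> u) \<Zcomp> j" "f \<in> hom C (Src C q) (Tgt C j)"
proof -
  obtain i where i: "retraction_of C i q" using assms by (auto simp: normal_factorisation_def)
  have j: "j \<in> incl C (Src C j) (Tgt C j)"
    using assms Inc_incl by (simp add: normal_factorisation_def)
  have iq: "i \<in> hom C (Src C i) (Tgt C i)" "q \<in> hom C (Tgt C i) (Src C i)" "i \<Zcomp> q = Idn C (Src C i)"
    using i incl_hom[OF Inc_incl[of i]] by (auto simp: retraction_of_def)
  have u: "isomorphism C u" "u \<in> hom C (Src C i) (Src C j)"
    using assms hom_Tgt[OF iq(2)] by (auto simp: normal_factorisation_def isomorphism_def hom_def)
  obtain v where "v \<in> hom C (Src C j) (Src C i)" "v \<Zcomp> u = Idn C (Src C j)"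
    using isoE[OF u] by blast
  then have "u \<in> split_epis C (Src C i) (Src C j)" using u by (auto simp: split_epis_def)
  moreover have "q \<in> split_epis C (Src C q) (Src C i)"
    using iq hom_Src[OF iq(2)] by (auto simp: split_epis_def)
  ultimately show qu: "q \<Zcomp> u \<in> split_epis C (Src C q) (Src C j)"
    using split_epis_comp by blast
  show f: "f = (q \<Zcomp> u) \<Zcomp> j" using assms by (simp add: normal_factorisation_def)
  show "j \<in> incl C (Src C j) (Tgt C j)" by (rule j)
  show "f \<in> hom C (Src C q) (Tgt C j)"
    unfolding f using split_epis_hom[OF qu] incl_hom[OF j] by (rule Comp_in_hom)
qed

text \<open>A section s of h gives \<open>j = (s \<Zcomp> h') \<Zcomp> j'\<close>, so dividing one
  inclusion by the other shows that c lies below c'. By symmetry and antisymmetry the two middle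
  objects agree; then parallel inclusions coincide, and cancelling the monomorphism j gives the
  rest.\<close>

lemma split_epi_factor_unique:
  assumes h: "h \<in> split_epis C a c" and j: "j \<in> incl C c b"
    and h': "h' \<in> split_epis C a c'" and j': "j' \<in> incl C c' b"
    and eq: "h \<Zcomp> j = h' \<Zcomp> j'"
  shows "c = c'" "h = h'" "j = j'"
proof -
  have *: "\<exists>k. k \<in> incl C c c'"
    if h: "h \<in> split_epis C a c" and j: "j \<in> incl C c b" and h': "h' \<in> split_epis C a c'"
      and j': "j' \<in> incl C c' b" and eq: "h \<Zcomp> j = h' \<Zcomp> j'" for h c j h' c' j'
  proof -
    obtain s where s: "s \<in> hom C c a" "s \<Zcomp> h = Idn C c" using h by (auto simp: split_epis_def)
    have "j = s \<Zcomp> (h \<Zcomp> j)"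
      using Comp_assoc[OF s(1) split_epis_hom[OF h] incl_hom[OF j]] s(2) Idn_left[OF incl_hom[OF j]]
      by simp
    also have "\<dots> = (s \<Zcomp> h') \<Zcomp> j'"
      using Comp_assoc[OF s(1) split_epis_hom[OF h'] incl_hom[OF j']] eq by simp
    finally show ?thesis
      using incl_divide[OF j j' Comp_in_hom[OF s(1) split_epis_hom[OF h']]] by blast
  qed
  show "c = c'"
    using *[OF h j h' j' eq] *[OF h' j' h j eq[symmetric]] incl_antisym by blast
  then show "j = j'" using j j' incl_unique by blast
  then show "h = h'"
    using incl_mono[OF j split_epis_hom[OF h]] split_epis_hom[OF h'] eq \<open>c = c'\<close> by blast
qed

text \<open>A split epimorphism has a normal factorisation and also the trivial one with an identity
  as its inclusion. Uniqueness of the factorisation forces the inclusion of the former to be an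
  identity.\<close>

lemma split_epi_retraction_iso:
  assumes h: "h \<in> split_epis C a b"
  obtains c i q u v j where "i \<in> incl C c a" "q \<in> hom C a c" "i \<Zcomp> q = Idn C c"
    "u \<in> hom C c b" "v \<in> hom C b c" "u \<Zcomp> v = Idn C c" "v \<Zcomp> u = Idn C b" "h = q \<Zcomp> u"
    "normal_factorisation C h q u j"
proof -
  note hom = split_epis_hom[OF h]
  obtain q u j where n: "normal_factorisation C h q u j"
    using normal hom_Mor[OF hom] unfolding normal_category_def by blast
  note f = normal_factorisation_split_epi[OF n]
  have ab: "Src C q = a" "Tgt C j = b" using f(4) hom by (auto simp: hom_def)
  have "Src C j = b \<and> j = Idn C b \<and> h = q \<Zcomp> u"
    using split_epi_factor_unique[OF f(1)[unfolded ab] f(2)[unfolded ab] h incl_Idn] f(3)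
      hom_Ob[OF hom] Idn_right[OF hom] by simp
  then have j: "Src C j = b" "h = q \<Zcomp> u" by auto
  obtain i where i: "retraction_of C i q" using n by (auto simp: normal_factorisation_def)
  have i': "i \<in> incl C (Src C i) (Tgt C i)" using i Inc_incl by (simp add: retraction_of_def)
  have iq: "q \<in> hom C (Tgt C i) (Src C i)" "i \<Zcomp> q = Idn C (Src C i)" "Tgt C i = a"
    using i ab by (auto simp: retraction_of_def hom_def)
  have u: "isomorphism C u" "u \<in> hom C (Src C i) b"
    using n j(1) hom_Tgt[OF iq(1)] by (auto simp: normal_factorisation_def isomorphism_def hom_def)
  then obtain v where "v \<in> hom C b (Src C i)" "u \<Zcomp> v = Idn C (Src C i)" "v \<Zcomp> u = Idn C b"
    using isoE by blast
  then show thesis using that i' iq u j n by auto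
qed

text \<open>This resolves the definite description in \<open>epi_part\<close>: to compute an
  epimorphic part it suffices to exhibit any split epimorphism followed by an inclusion. Such an h
  is itself a retraction followed by an isomorphism, so it extends to a normal
  factorisation.\<close>

lemma epi_part_eq:
  assumes h: "h \<in> split_epis C a c" and j: "j \<in> incl C c b"
  shows "epi_part C (h \<Zcomp> j) = h"
proof -
  obtain q u k d where n: "h = q \<Zcomp> u" "normal_factorisation C h q u k" and u: "u \<in> hom C d c"
    using split_epi_retraction_iso[OF h] by metis
  have "(\<exists>i. retraction_of C i q) \<and> isomorphism C u \<and> Tgt C q = Src C u"
    using n(2) unfolding normal_factorisation_def by blast
  then have "normal_factorisation C (h \<Zcomp> j) q u j"
    using j hom_Tgt[OF u] n(1) by (simp add: normal_factorisation_def incl_def hom_def)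
  moreover have "q' \<Zcomp> u' = h" if n': "normal_factorisation C (h \<Zcomp> j) q' u' j'" for q' u' j'
  proof -
    note f = normal_factorisation_split_epi[OF n']
    have ab: "Src C q' = a" "Tgt C j' = b"
      using f(4) Comp_in_hom[OF split_epis_hom[OF h] incl_hom[OF j]] by (auto simp: hom_def)
    show ?thesis
      using split_epi_factor_unique(2)[OF h j f(1)[unfolded ab] f(2)[unfolded ab] f(3)] by simp
  qed
  ultimately show ?thesis
    unfolding epi_part_def using n(1) by (intro the_equality) blast+
qed

lemma epi_part_factor:
  assumes f: "f \<in> hom C a b"
  obtains j where "epi_part C f \<in> split_epis C a (img C f)" "j \<in> incl C (img C f) b"
    "f = epi_part C f \<Zcomp> j"
proof -
  obtain q u j where n: "normal_factorisation C f q u j"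
    using normal hom_Mor[OF f] unfolding normal_category_def by blast
  note nf = normal_factorisation_split_epi[OF n]
  have ab: "Src C q = a" "Tgt C j = b" using nf(4) f by (auto simp: hom_def)
  have e: "epi_part C f = q \<Zcomp> u" using epi_part_eq[OF nf(1,2)] nf(3) by simp
  have "img C f = Src C j"
    using hom_Tgt[OF split_epis_hom[OF nf(1)]] by (simp add: img_def e)
  then show thesis
    using that[of j] nf(1,2) nf(3)[folded e] unfolding ab e[symmetric] by simp
qed

lemma img_eq:
  assumes "h \<in> split_epis C a c" "j \<in> incl C c b"
  shows "img C (h \<Zcomp> j) = c"
  using epi_part_eq[OF assms] hom_Tgt[OF split_epis_hom[OF assms(1)]] by (simp add: img_def)

lemma epi_part_split_epi:
  assumes "h \<in> split_epis C a b"
  shows "epi_part C h = h" "img C h = b"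
proof -
  have b: "b \<in> Ob C" using hom_Ob(2)[OF split_epis_hom[OF assms]] .
  show "epi_part C h = h" "img C h = b"
    using epi_part_eq[OF assms incl_Idn[OF b]] img_eq[OF assms incl_Idn[OF b]]
      Idn_right[OF split_epis_hom[OF assms]] by simp_all
qed

lemma epi_part_comp_incl:
  assumes "f \<in> hom C a b" "j \<in> incl C b c"
  shows "epi_part C (f \<Zcomp> j) = epi_part C f" "img C (f \<Zcomp> j) = img C f"
proof -
  obtain k where k: "epi_part C f \<in> split_epis C a (img C f)" "k \<in> incl C (img C f) b"
    "f = epi_part C f \<Zcomp> k" by (rule epi_part_factor[OF assms(1)])
  have "f \<Zcomp> j = epi_part C f \<Zcomp> (k \<Zcomp> j)"
    using Comp_assoc[OF split_epis_hom[OF k(1)] incl_hom[OF k(2)] incl_hom[OF assms(2)]] k(3) by simp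
  then show "epi_part C (f \<Zcomp> j) = epi_part C f" "img C (f \<Zcomp> j) = img C f"
    using epi_part_eq[OF k(1) incl_comp[OF k(2) assms(2)]]
      img_eq[OF k(1) incl_comp[OF k(2) assms(2)]] by simp_all
qed

lemma epi_part_comp_split_epi:
  assumes "h \<in> split_epis C a b" "f \<in> hom C b c"
  shows "epi_part C (h \<Zcomp> f) = h \<Zcomp> epi_part C f" "img C (h \<Zcomp> f) = img C f"
proof -
  obtain k where k: "epi_part C f \<in> split_epis C b (img C f)" "k \<in> incl C (img C f) c"
    "f = epi_part C f \<Zcomp> k" by (rule epi_part_factor[OF assms(2)])
  have "h \<Zcomp> f = (h \<Zcomp> epi_part C f) \<Zcomp> k"
    using Comp_assoc[OF split_epis_hom[OF assms(1)] split_epis_hom[OF k(1)] incl_hom[OF k(2)]] k(3)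
    by simp
  then show "epi_part C (h \<Zcomp> f) = h \<Zcomp> epi_part C f" "img C (h \<Zcomp> f) = img C f"
    using epi_part_eq[OF split_epis_comp[OF assms(1) k(1)] k(2)]
      img_eq[OF split_epis_comp[OF assms(1) k(1)] k(2)] by simp_all
qed


section \<open>The semigroup of cones\<close>

lemma cone_at_hom: "cone_at C z \<gamma> \<Longrightarrow> c \<in> Ob C \<Longrightarrow> \<gamma> c \<in> hom C c z"
  by (auto simp: cone_at_def)

lemma cone_at_incl: "cone_at C z \<gamma> \<Longrightarrow> j \<in> incl C a b \<Longrightarrow> j \<Zcomp> \<gamma> b = \<gamma> a"
  by (auto simp: cone_at_def incl_def hom_def)

lemma cone_at_Ob: "cone_at C z \<gamma> \<Longrightarrow> z \<in> Ob C"
  by (simp add: cone_at_def)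

lemma cone_at_unique:
  assumes "cone_at C z \<gamma>" "cone_at C w \<gamma>"
  shows "z = w"
  using cone_at_hom[OF assms(1) cone_at_Ob[OF assms(1)]] cone_at_hom[OF assms(2) cone_at_Ob[OF assms(1)]]
  by (simp add: hom_def)

lemma vertex_eq: "cone_at C z \<gamma> \<Longrightarrow> vertex C \<gamma> = z"
  unfolding vertex_def using cone_at_unique by blast

text \<open>Compatibility with inclusions is inherited from \<gamma>; the difficulty is to find an
  invertible component. If \<gamma>(c) is invertible with inverse g and f is a retraction q onto e
  followed by an isomorphism u, then g carries the subobject e of z to a subobject c' of c, namely
  the image of i followed by g, and the component at c' is invertible.\<close>

lemma cone_at_cone_star:
  assumes \<gamma>: "cone_at C z \<gamma>" and f: "f \<in> split_epis C z w"
  shows "cone_at C w (cone_star C \<gamma> f)"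
proof -
  note f_hom = split_epis_hom[OF f]
  obtain e i q u v where
    i: "i \<in> incl C e z" and q: "q \<in> hom C z e" and iq: "i \<Zcomp> q = Idn C e" and
    u: "u \<in> hom C e w" and v: "v \<in> hom C w e" and uv: "u \<Zcomp> v = Idn C e" "v \<Zcomp> u = Idn C w" and
    fqu: "f = q \<Zcomp> u"
    by (rule split_epi_retraction_iso[OF f])
  obtain c where c: "c \<in> Ob C" "isomorphism C (\<gamma> c)" using \<gamma> by (auto simp: cone_at_def)
  obtain g where g: "g \<in> hom C z c" "\<gamma> c \<Zcomp> g = Idn C c" "g \<Zcomp> \<gamma> c = Idn C z"
    using isoE[OF c(2) cone_at_hom[OF \<gamma> c(1)]] .
  note \<gamma>c = cone_at_hom[OF \<gamma> c(1)] and i_hom = incl_hom[OF i]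
  have ig: "i \<Zcomp> g \<in> hom C e c" using i_hom g(1) by (rule Comp_in_hom)
  obtain j where h: "epi_part C (i \<Zcomp> g) \<in> split_epis C e (img C (i \<Zcomp> g))"
    and j: "j \<in> incl C (img C (i \<Zcomp> g)) c" and hj: "i \<Zcomp> g = epi_part C (i \<Zcomp> g) \<Zcomp> j"
    by (rule epi_part_factor[OF ig])
  define h c' where "h = epi_part C (i \<Zcomp> g)" and "c' = img C (i \<Zcomp> g)"
  have h: "h \<in> split_epis C e c'" and j: "j \<in> incl C c' c" and hj: "h \<Zcomp> j = i \<Zcomp> g"
    using h j hj by (simp_all add: h_def c'_def)
  note h_hom = split_epis_hom[OF h] and j_hom = incl_hom[OF j]
  obtain s where s: "s \<in> hom C c' e" "s \<Zcomp> h = Idn C c'" using h by (auto simp: split_epis_def)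
  \<comment> \<open>The candidate inverse of h: go from c' into c, apply \<gamma>(c), and retract
    onto e. It is a right inverse of h, and h has a left inverse s, so the two coincide.\<close>
  define t where "t = j \<Zcomp> (\<gamma> c \<Zcomp> q)"
  have t: "t \<in> hom C c' e" using j_hom \<gamma>c q unfolding t_def by (blast intro: Comp_in_hom)
  have "h \<Zcomp> t = (h \<Zcomp> j) \<Zcomp> (\<gamma> c \<Zcomp> q)"
    unfolding t_def using h_hom j_hom \<gamma>c q by (simp add: hom_def cat_simps)
  also have "\<dots> = i \<Zcomp> ((g \<Zcomp> \<gamma> c) \<Zcomp> q)"
    unfolding hj using i_hom g(1) \<gamma>c q by (simp add: hom_def cat_simps)
  also have "\<dots> = Idn C e" using iq g(3) Idn_left[OF q] by simp
  finally have ht: "h \<Zcomp> t = Idn C e" .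
  then have "s = t" using inverse_unique[OF h_hom s(1) t s(2)] by simp
  then have th: "t \<Zcomp> h = Idn C c'" using s by simp
  have c': "c' \<in> Ob C" using hom_Ob(1)[OF t] .
  have tu: "\<gamma> c' \<Zcomp> f = t \<Zcomp> u"
    using cone_at_incl[OF \<gamma> j, symmetric] j_hom \<gamma>c q u by (simp add: hom_def cat_simps t_def fqu)
  have "(t \<Zcomp> u) \<Zcomp> (v \<Zcomp> h) = t \<Zcomp> ((u \<Zcomp> v) \<Zcomp> h)"
    using t u v h_hom by (simp add: hom_def cat_simps)
  then have tuvh: "(t \<Zcomp> u) \<Zcomp> (v \<Zcomp> h) = Idn C c'" using uv th Idn_left[OF h_hom] by simp
  have "(v \<Zcomp> h) \<Zcomp> (t \<Zcomp> u) = v \<Zcomp> ((h \<Zcomp> t) \<Zcomp> u)"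
    using t u v h_hom by (simp add: hom_def cat_simps)
  then have vhtu: "(v \<Zcomp> h) \<Zcomp> (t \<Zcomp> u) = Idn C w" using uv ht Idn_left[OF u] by simp
  have iso: "isomorphism C (\<gamma> c' \<Zcomp> f)"
    unfolding tu using isoI[OF Comp_in_hom[OF t u] Comp_in_hom[OF v h_hom] tuvh vhtu] .
  have "j \<Zcomp> (\<gamma> (Tgt C j) \<Zcomp> f) = \<gamma> (Src C j) \<Zcomp> f" if "j \<in> Inc C" for j
  proof -
    note j = Inc_incl[OF that]
    note b = hom_Ob(2)[OF incl_hom[OF j]]
    show ?thesis
      using Comp_assoc[OF incl_hom[OF j] cone_at_hom[OF \<gamma> b] f_hom] cone_at_incl[OF \<gamma> j] by simp
  qed
  then show ?thesis
    using iso c' hom_Ob[OF f_hom] Comp_in_hom[OF cone_at_hom[OF \<gamma>] f_hom]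
      hom_Ob[OF incl_hom[OF Inc_incl]]
    unfolding cone_at_def cone_star_def by auto
qed

lemma cone_star_comp:
  assumes "cone_at C z \<gamma>" "f \<in> hom C z w" "g \<in> hom C w x"
  shows "cone_star C (cone_star C \<gamma> f) g = cone_star C \<gamma> (f \<Zcomp> g)"
  using Comp_assoc[OF cone_at_hom[OF assms(1)] assms(2,3)] by (auto simp: cone_star_def)

lemma cone_star_Idn:
  assumes "cone_at C z \<gamma>"
  shows "cone_star C \<gamma> (Idn C z) = \<gamma>"
  using assms Idn_right[OF cone_at_hom[OF assms]]
  by (auto simp: cone_star_def cone_at_def PiE_def extensional_def fun_eq_iff)

lemma elems_cones: "\<gamma> \<in> elems (cones C) \<longleftrightarrow> (\<exists>z. cone_at C z \<gamma>)"
  by (simp add: cones_def)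

lemma cones_mult:
  assumes "cone_at C z \<gamma>"
  shows "\<gamma> \<cdot>\<^bsub>cones C\<^esub> \<delta> = cone_star C \<gamma> (epi_part C (\<delta> z))"
  using vertex_eq[OF assms] by (simp add: cones_def)

lemma cone_at_mult:
  assumes "cone_at C z \<gamma>" "cone_at C w \<delta>"
  shows "cone_at C (img C (\<delta> z)) (\<gamma> \<cdot>\<^bsub>cones C\<^esub> \<delta>)"
  unfolding cones_mult[OF assms(1)]
  using cone_at_cone_star[OF assms(1)] epi_part_factor[OF cone_at_hom[OF assms(2) cone_at_Ob[OF assms(1)]]]
  by metis

text \<open>For associativity, both products equal \<gamma> starred with the epimorphic part of
  \<delta>(x) followed by the epimorphic part of \<eta>(y). Writing \<delta>(x) as h followed by an
  inclusion j, the component \<eta>(m) is j followed by \<eta>(y), and inclusions appended on the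
  right do not change epimorphic parts.\<close>

lemma semigroup_cones: "semigroup_on (cones C)"
  unfolding semigroup_on_def
proof (intro conjI ballI)
  fix \<gamma> \<delta> assume "\<gamma> \<in> elems (cones C)" "\<delta> \<in> elems (cones C)"
  then show "\<gamma> \<cdot>\<^bsub>cones C\<^esub> \<delta> \<in> elems (cones C)"
    unfolding elems_cones using cone_at_mult by (elim exE) (rule exI)
next
  fix \<gamma> \<delta> \<eta> assume "\<gamma> \<in> elems (cones C)" "\<delta> \<in> elems (cones C)" "\<eta> \<in> elems (cones C)"
  then obtain x y z where \<gamma>: "cone_at C x \<gamma>" and \<delta>: "cone_at C y \<delta>" and \<eta>: "cone_at C z \<eta>"
    by (auto simp: elems_cones)
  note \<delta>x = cone_at_hom[OF \<delta> cone_at_Ob[OF \<gamma>]] and \<eta>y = cone_at_hom[OF \<eta> cone_at_Ob[OF \<delta>]]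
  obtain j where j: "epi_part C (\<delta> x) \<in> split_epis C x (img C (\<delta> x))" "j \<in> incl C (img C (\<delta> x)) y"
    "\<delta> x = epi_part C (\<delta> x) \<Zcomp> j" by (rule epi_part_factor[OF \<delta>x])
  define h m where "h = epi_part C (\<delta> x)" and "m = img C (\<delta> x)"
  have h: "h \<in> split_epis C x m" and j': "j \<in> incl C m y" and hj: "\<delta> x = h \<Zcomp> j"
    using j by (simp_all add: h_def m_def)
  have m: "m \<in> Ob C" using hom_Ob(1)[OF incl_hom[OF j']] .
  obtain k where k: "epi_part C (\<eta> y) \<in> split_epis C y (img C (\<eta> y))"
    "k \<in> incl C (img C (\<eta> y)) z" "\<eta> y = epi_part C (\<eta> y) \<Zcomp> k" by (rule epi_part_factor[OF \<eta>y])
  note k_hom = split_epis_hom[OF k(1)]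
  have m_hom: "j \<Zcomp> epi_part C (\<eta> y) \<in> hom C m (img C (\<eta> y))"
    using incl_hom[OF j'] k_hom by (rule Comp_in_hom)
  have "j \<Zcomp> \<eta> y = (j \<Zcomp> epi_part C (\<eta> y)) \<Zcomp> k"
    using Comp_assoc[OF incl_hom[OF j'] k_hom incl_hom[OF k(2)]] k(3) by simp
  then have \<eta>m: "epi_part C (\<eta> m) = epi_part C (j \<Zcomp> epi_part C (\<eta> y))"
    using epi_part_comp_incl(1)[OF m_hom k(2)] cone_at_incl[OF \<eta> j'] by simp
  have 1: "\<gamma> \<cdot>\<^bsub>cones C\<^esub> \<delta> = cone_star C \<gamma> h" by (simp add: cones_mult[OF \<gamma>] h_def)
  have "cone_at C m (cone_star C \<gamma> h)" using cone_at_cone_star[OF \<gamma> h] .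
  then have "(\<gamma> \<cdot>\<^bsub>cones C\<^esub> \<delta>) \<cdot>\<^bsub>cones C\<^esub> \<eta> = cone_star C (cone_star C \<gamma> h) (epi_part C (\<eta> m))"
    unfolding 1 by (rule cones_mult)
  also have "\<dots> = cone_star C \<gamma> (h \<Zcomp> epi_part C (\<eta> m))"
    using epi_part_factor[OF cone_at_hom[OF \<eta> m]] cone_star_comp[OF \<gamma> split_epis_hom[OF h] split_epis_hom]
    by metis
  also have "h \<Zcomp> epi_part C (\<eta> m) = epi_part C (h \<Zcomp> (j \<Zcomp> epi_part C (\<eta> y)))"
    unfolding \<eta>m using epi_part_comp_split_epi(1)[OF h m_hom] by simp
  also have "h \<Zcomp> (j \<Zcomp> epi_part C (\<eta> y)) = \<delta> x \<Zcomp> epi_part C (\<eta> y)"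
    using Comp_assoc[OF split_epis_hom[OF h] incl_hom[OF j'] k_hom] hj by simp
  also have "\<dots> = (\<delta> \<cdot>\<^bsub>cones C\<^esub> \<eta>) x"
    using cone_at_Ob[OF \<gamma>] by (simp add: cones_mult[OF \<delta>] cone_star_def)
  also have "cone_star C \<gamma> (epi_part C ((\<delta> \<cdot>\<^bsub>cones C\<^esub> \<eta>) x)) = \<gamma> \<cdot>\<^bsub>cones C\<^esub> (\<delta> \<cdot>\<^bsub>cones C\<^esub> \<eta>)"
    by (simp add: cones_mult[OF \<gamma>])
  finally show "(\<gamma> \<cdot>\<^bsub>cones C\<^esub> \<delta>) \<cdot>\<^bsub>cones C\<^esub> \<eta> = \<gamma> \<cdot>\<^bsub>cones C\<^esub> (\<delta> \<cdot>\<^bsub>cones C\<^esub> \<eta>)" .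
qed

text \<open>If the square of \<gamma> is \<gamma>, comparing vertices shows that z is the image of
  \<gamma>(z). Hence \<gamma>(z) is its own epimorphic part, a split epimorphism and idempotent, and
  its section cancels it to the identity.\<close>

lemma cone_idempotent_iff:
  assumes \<gamma>: "cone_at C z \<gamma>"
  shows "\<gamma> \<cdot>\<^bsub>cones C\<^esub> \<gamma> = \<gamma> \<longleftrightarrow> \<gamma> z = Idn C z"
proof
  note z = cone_at_Ob[OF \<gamma>] and \<gamma>z = cone_at_hom[OF \<gamma> cone_at_Ob[OF \<gamma>]]
  assume i: "\<gamma> \<cdot>\<^bsub>cones C\<^esub> \<gamma> = \<gamma>"
  have im: "img C (\<gamma> z) = z" using cone_at_mult[OF \<gamma> \<gamma>] \<gamma> i cone_at_unique by simp
  obtain j where j: "epi_part C (\<gamma> z) \<in> split_epis C z z" "j \<in> incl C z z" "\<gamma> z = epi_part C (\<gamma> z) \<Zcomp> j"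
    using epi_part_factor[OF \<gamma>z] im by metis
  have "j = Idn C z" using incl_unique[OF j(2) incl_Idn[OF z]] .
  then have e: "epi_part C (\<gamma> z) = \<gamma> z" using j Idn_right[OF split_epis_hom[OF j(1)]] by simp
  have "(\<gamma> \<cdot>\<^bsub>cones C\<^esub> \<gamma>) z = \<gamma> z" using i by simp
  then have \<gamma>\<gamma>: "\<gamma> z \<Zcomp> \<gamma> z = \<gamma> z" using z by (simp add: cones_mult[OF \<gamma>] cone_star_def e)
  obtain s where s: "s \<in> hom C z z" "s \<Zcomp> \<gamma> z = Idn C z" using j(1) e by (auto simp: split_epis_def)
  have "s \<Zcomp> (\<gamma> z \<Zcomp> \<gamma> z) = \<gamma> z" using Comp_assoc[OF s(1) \<gamma>z \<gamma>z] s(2) Idn_left[OF \<gamma>z] by simp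
  then show "\<gamma> z = Idn C z" using \<gamma>\<gamma> s by simp
next
  assume "\<gamma> z = Idn C z"
  then have "epi_part C (\<gamma> z) = Idn C z"
    using epi_part_split_epi(1)[OF split_epis_Idn[OF cone_at_Ob[OF \<gamma>]]] by simp
  then show "\<gamma> \<cdot>\<^bsub>cones C\<^esub> \<gamma> = \<gamma>" using cone_star_Idn[OF \<gamma>] by (simp add: cones_mult[OF \<gamma>])
qed

text \<open>The factor to multiply by is \<mu> starred with f, where \<mu> is a cone with vertex z
  and identity component at z; such cones are supplied by the last axiom of normal
  categories.\<close>

lemma cone_star_in_right_ideal:
  assumes \<gamma>: "cone_at C z \<gamma>" and f: "f \<in> split_epis C z w"
  shows "cone_star C \<gamma> f \<in> principal_right_ideal (cones C) \<gamma>"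
proof -
  note z = cone_at_Ob[OF \<gamma>]
  obtain \<mu> where \<mu>: "cone_at C z \<mu>" "\<mu> z = Idn C z"
    using normal z unfolding normal_category_def by blast
  have "(cone_star C \<mu> f) z = f"
    using z \<mu>(2) Idn_left[OF split_epis_hom[OF f]] by (simp add: cone_star_def)
  then have "\<gamma> \<cdot>\<^bsub>cones C\<^esub> cone_star C \<mu> f = cone_star C \<gamma> f"
    using epi_part_split_epi(1)[OF f] by (simp add: cones_mult[OF \<gamma>])
  moreover have "cone_star C \<mu> f \<in> elems (cones C)"
    using cone_at_cone_star[OF \<mu>(1) f] elems_cones by blast
  ultimately show ?thesis unfolding principal_right_ideal_def by (metis imageI insertI2)
qed

end


section \<open>The left regular band of a supported category\<close>

text \<open>For supported C this is the idempotent cone with vertex c in the one class connected to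
  c. Membership in \<open>\<Union>(DSet C)\<close> avoids naming that class, and idempotency is
  expressed through the component at the vertex, as justified by
  \<open>cone_idempotent_iff\<close>.\<close>

definition supp_cone :: "('o, 'm, 'x) conn_cat_scheme \<Rightarrow> 'o \<Rightarrow> 'o \<Rightarrow> 'm" where
  "supp_cone C c = (THE \<gamma>. \<gamma> \<in> \<Union>(DSet C) \<and> cone_at C c \<gamma> \<and> \<gamma> c = Idn C c)"

definition supp_class :: "('o, 'm, 'x) conn_cat_scheme \<Rightarrow> 'o \<Rightarrow> ('o \<Rightarrow> 'm) set" where
  "supp_class C c = green_R (cones C) `` {supp_cone C c}"

definition rband :: "('o, 'm, 'x) conn_cat_scheme \<Rightarrow> 'o sgrp" where
  "rband C = \<lparr>elems = Ob C, mult = (\<lambda>x y. img C (supp_cone C x y))\<rparr>"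

definition the_incl :: "('o, 'm, 'x) subobj_cat_scheme \<Rightarrow> 'o \<Rightarrow> 'o \<Rightarrow> 'm" where
  "the_incl C a b = (THE j. j \<in> incl C a b)"

lemma (in normal_cat) the_incl_eq: "j \<in> incl C a b \<Longrightarrow> the_incl C a b = j"
  unfolding the_incl_def using incl_unique by blast

locale supported_cat =
  fixes C :: "('o, 'm, 'x) conn_cat_scheme" (structure)
  assumes supported: "supported_category C"
begin

lemma connected: "connected_category C"
  using supported by (simp add: supported_category_def)

sublocale normal_cat
  using connected by unfold_locales (simp add: connected_category_def)

lemma down_set: "R_down_set (cones C) (DSet C)"
  using connected by (simp add: connected_category_def)

lemma DSet_class:
  assumes "X \<in> DSet C" "\<gamma> \<in> X"
  shows "X = green_R (cones C) `` {\<gamma>}" "\<gamma> \<in> elems (cones C)"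
proof -
  have X: "X \<in> elems (cones C) // green_R (cones C)"
    using down_set assms by (auto simp: R_down_set_def)
  then obtain \<delta> where \<delta>: "X = green_R (cones C) `` {\<delta>}" by (rule quotientE)
  then show "X = green_R (cones C) `` {\<gamma>}"
    using equiv_class_eq[OF equiv_green_R, of \<delta> \<gamma>] assms(2) by simp
  show "\<gamma> \<in> elems (cones C)"
    using in_quotient_imp_subset[OF equiv_green_R X] assms(2) by (rule subsetD)
qed

lemma down_set_ideal:
  assumes \<gamma>: "\<gamma> \<in> \<Union>(DSet C)" and \<delta>: "\<delta> \<in> elems (cones C)" "\<delta> \<in> principal_right_ideal (cones C) \<gamma>"
  shows "\<delta> \<in> \<Union>(DSet C)"
proof -
  obtain Y where Y: "Y \<in> DSet C" "\<gamma> \<in> Y" using \<gamma> by blast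
  let ?X = "green_R (cones C) `` {\<delta>}"
  have \<delta>X: "\<delta> \<in> ?X" using \<delta>(1) by (simp add: green_R_def)
  have X: "?X \<in> elems (cones C) // green_R (cones C)" using \<delta>(1) by (rule quotientI)
  have "principal_right_ideal (cones C) \<delta> \<subseteq> principal_right_ideal (cones C) \<gamma>"
    using principal_right_ideal_mono[OF semigroup_cones \<delta>(1) DSet_class(2)[OF Y] \<delta>(2)] .
  then have "R_le (cones C) ?X Y"
    using X Y \<delta>X down_set unfolding R_le_def R_down_set_def by blast
  then have "?X \<in> DSet C" using X Y(1) down_set unfolding R_down_set_def by blast
  then show ?thesis using \<delta>X by blast
qed

text \<open>The down-set condition makes \<open>\<Union>(DSet C)\<close> a right ideal of the
  semigroup of cones. With this closure, a cone obtained from some \<open>supp_cone\<close> by a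
  split epimorphism can be recognised as another \<open>supp_cone\<close> from its identity
  component alone.\<close>

lemma cone_star_DSet:
  assumes "\<gamma> \<in> \<Union>(DSet C)" "cone_at C z \<gamma>" "f \<in> split_epis C z w"
  shows "cone_star C \<gamma> f \<in> \<Union>(DSet C)"
  using down_set_ideal[OF assms(1)] cone_at_cone_star[OF assms(2,3)] elems_cones
    cone_star_in_right_ideal[OF assms(2,3)] by blast

lemma idempotent_cone_in_iff:
  "idempotent_cone_in C c X \<gamma> \<longleftrightarrow> \<gamma> \<in> X \<and> cone_at C c \<gamma> \<and> \<gamma> c = Idn C c"
  using cone_idempotent_iff by (auto simp: idempotent_cone_in_def)

text \<open>Two such cones lie in the same R-class because c is supported by only one class. For
  R-related idempotents the product \<open>\<delta> \<cdot> \<gamma>\<close> is \<gamma>; it is also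
  \<delta>, since the component of \<gamma> at the common vertex is an identity.\<close>

lemma supp_cone_ex1:
  assumes c: "c \<in> Ob C"
  shows "\<exists>!\<gamma>. \<gamma> \<in> \<Union>(DSet C) \<and> cone_at C c \<gamma> \<and> \<gamma> c = Idn C c"
proof -
  have ex1: "\<exists>!X. X \<in> DSet C \<and> connected_to C c X"
    using supported c by (simp add: supported_category_def)
  then obtain X \<gamma> where X: "X \<in> DSet C" "\<gamma> \<in> X" "cone_at C c \<gamma>" "\<gamma> c = Idn C c"
    by (auto simp: connected_to_def idempotent_cone_in_iff)
  have "\<delta> = \<gamma>" if \<delta>: "\<delta> \<in> \<Union>(DSet C)" "cone_at C c \<delta>" "\<delta> c = Idn C c" for \<delta>
  proof -
    obtain Y where Y: "Y \<in> DSet C" "\<delta> \<in> Y" using \<delta> by blast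
    then have "Y = X"
      using ex1 X \<delta> unfolding connected_to_def idempotent_cone_in_iff by blast
    then have "(\<gamma>, \<delta>) \<in> green_R (cones C)" using DSet_class(1)[OF X(1,2)] Y by blast
    then have "\<delta> \<cdot>\<^bsub>cones C\<^esub> \<gamma> = \<gamma>"
      using green_R_iff_idempotents[OF semigroup_cones] cone_idempotent_iff X(3,4) \<delta>(2,3) elems_cones
      by blast
    moreover have "\<delta> \<cdot>\<^bsub>cones C\<^esub> \<gamma> = \<delta>"
      using cones_mult[OF \<delta>(2)] X(4) epi_part_split_epi(1)[OF split_epis_Idn[OF c]]
        cone_star_Idn[OF \<delta>(2)] by simp
    ultimately show ?thesis by simp
  qed
  then show ?thesis using X by blast
qed

lemma supp_cone:
  assumes "c \<in> Ob C"
  shows "supp_cone C c \<in> \<Union>(DSet C)" "cone_at C c (supp_cone C c)" "supp_cone C c c = Idn C c"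
  using theI'[OF supp_cone_ex1[OF assms]] by (simp_all add: supp_cone_def)

lemma supp_cone_eq:
  assumes "\<gamma> \<in> \<Union>(DSet C)" "cone_at C c \<gamma>" "\<gamma> c = Idn C c"
  shows "supp_cone C c = \<gamma>"
  unfolding supp_cone_def using assms supp_cone_ex1[OF cone_at_Ob[OF assms(2)]]
  by (intro the1_equality) auto

lemma supp_cone_elems: "c \<in> Ob C \<Longrightarrow> supp_cone C c \<in> elems (cones C)"
  using supp_cone(2) elems_cones by blast

lemma supp_cone_idem: "c \<in> Ob C \<Longrightarrow> supp_cone C c \<cdot>\<^bsub>cones C\<^esub> supp_cone C c = supp_cone C c"
  using supp_cone(2,3) cone_idempotent_iff by blast

lemma supp_cone_hom: "x \<in> Ob C \<Longrightarrow> y \<in> Ob C \<Longrightarrow> supp_cone C x y \<in> hom C y x"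
  using cone_at_hom supp_cone(2) by blast

lemma supp_cone_inj: "x \<in> Ob C \<Longrightarrow> y \<in> Ob C \<Longrightarrow> supp_cone C x = supp_cone C y \<Longrightarrow> x = y"
  using cone_at_unique supp_cone(2) by metis

lemma supp_class_DSet: "c \<in> Ob C \<Longrightarrow> supp_class C c \<in> DSet C"
  using supp_cone(1) DSet_class(1) unfolding supp_class_def by blast

lemma supp_cone_in_class: "c \<in> Ob C \<Longrightarrow> supp_cone C c \<in> supp_class C c"
  using supp_cone_elems by (simp add: supp_class_def green_R_def)

lemma connected_to_iff:
  assumes "X \<in> DSet C"
  shows "connected_to C c X \<longleftrightarrow> c \<in> Ob C \<and> X = supp_class C c"
proof
  assume "connected_to C c X"
  then obtain \<gamma> where \<gamma>: "\<gamma> \<in> X" "cone_at C c \<gamma>" "\<gamma> c = Idn C c"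
    by (auto simp: connected_to_def idempotent_cone_in_iff)
  then have "supp_cone C c = \<gamma>" using supp_cone_eq assms by blast
  then show "c \<in> Ob C \<and> X = supp_class C c"
    using cone_at_Ob[OF \<gamma>(2)] DSet_class(1)[OF assms \<gamma>(1)] by (simp add: supp_class_def)
next
  assume "c \<in> Ob C \<and> X = supp_class C c"
  then show "connected_to C c X"
    using supp_cone supp_cone_in_class unfolding connected_to_def idempotent_cone_in_iff by blast
qed

lemma idem_cone_eq:
  assumes "c \<in> Ob C"
  shows "idem_cone C c (supp_class C c) = supp_cone C c"
  unfolding idem_cone_def idempotent_cone_in_iff
  using supp_cone[OF assms] supp_cone_in_class[OF assms] supp_cone_eq supp_class_DSet[OF assms]
  by (intro the_equality) blast+

lemma supp_cone_incl:
  assumes "j \<in> incl C z x"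
  shows "supp_cone C x z = j"
proof -
  have x: "x \<in> Ob C" using hom_Ob(2)[OF incl_hom[OF assms]] .
  show ?thesis
    using cone_at_incl[OF supp_cone(2)[OF x] assms] supp_cone(3)[OF x] Idn_right[OF incl_hom[OF assms]]
    by simp
qed

lemma rband_simps [simp]: "elems (rband C) = Ob C" "x \<cdot>\<^bsub>rband C\<^esub> y = img C (supp_cone C x y)"
  by (simp_all add: rband_def)

text \<open>Write \<open>h = q \<Zcomp> u\<close> for the epimorphic part of \<open>\<epsilon>\<^sub>x(y)\<close>, with \<open>q\<close> a retraction \<open>y \<rightarrow> e\<close> and
  \<open>u : e \<rightarrow> g\<close> an isomorphism, and let \<open>p\<close> be a retraction \<open>x \<rightarrow> g\<close>. The uniqueness of the
  idempotent cones gives \<open>\<epsilon>\<^sub>g = \<epsilon>\<^sub>x \<star> p\<close> and \<open>\<epsilon>\<^sub>e = \<epsilon>\<^sub>y \<star> q\<close>. As \<open>\<epsilon>\<^sub>g(e) = u\<close>, also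
  \<open>\<epsilon>\<^sub>e = \<epsilon>\<^sub>g \<star> u\<inverse>\<close>.\<close>

lemma supp_cone_mult:
  assumes x: "x \<in> Ob C" and y: "y \<in> Ob C"
  shows "supp_cone C y \<cdot>\<^bsub>cones C\<^esub> supp_cone C x = supp_cone C (img C (supp_cone C x y))"
proof -
  define h g where "h = epi_part C (supp_cone C x y)" and "g = img C (supp_cone C x y)"
  obtain j where h: "h \<in> split_epis C y g" and j: "j \<in> incl C g x" and hj: "supp_cone C x y = h \<Zcomp> j"
    using epi_part_factor[OF supp_cone_hom[OF x y]] unfolding h_def g_def by metis
  note j_hom = incl_hom[OF j]
  obtain e i q u v where
    i: "i \<in> incl C e y" and q: "q \<in> hom C y e" and iq: "i \<Zcomp> q = Idn C e" and
    u: "u \<in> hom C e g" and v: "v \<in> hom C g e" and uv: "u \<Zcomp> v = Idn C e" "v \<Zcomp> u = Idn C g" and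
    hqu: "h = q \<Zcomp> u"
    by (rule split_epi_retraction_iso[OF h])
  note i_hom = incl_hom[OF i]
  have e: "e \<in> Ob C" and g: "g \<in> Ob C" using hom_Ob[OF u] .
  have "\<exists>p. retraction_of C j p"
    using normal j unfolding normal_category_def incl_def by blast
  then obtain p where p: "p \<in> hom C x g" "j \<Zcomp> p = Idn C g"
    using j_hom by (auto simp: retraction_of_def hom_def)
  have sq: "q \<in> split_epis C y e" using iso_split_epi[OF q i_hom iq] .
  have sp: "p \<in> split_epis C x g" using iso_split_epi[OF p(1) j_hom p(2)] .
  have sv: "v \<in> split_epis C g e" using iso_split_epi[OF v u uv(1)] .
  have xg: "supp_cone C g = cone_star C (supp_cone C x) p"
    using supp_cone_incl[OF j] p(2) g
    by (intro supp_cone_eq cone_star_DSet[OF _ _ sp] cone_at_cone_star[OF _ sp] supp_cone x)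
      (simp add: cone_star_def)
  have ye: "supp_cone C e = cone_star C (supp_cone C y) q"
    using supp_cone_incl[OF i] iq e
    by (intro supp_cone_eq cone_star_DSet[OF _ _ sq] cone_at_cone_star[OF _ sq] supp_cone y)
      (simp add: cone_star_def)
  have "supp_cone C x e = i \<Zcomp> ((q \<Zcomp> u) \<Zcomp> j)"
    using cone_at_incl[OF supp_cone(2)[OF x] i] hj hqu by simp
  also have "\<dots> = ((i \<Zcomp> q) \<Zcomp> u) \<Zcomp> j" using i_hom q u j_hom by (simp add: hom_def cat_simps)
  also have "\<dots> = u \<Zcomp> j" using iq Idn_left[OF u] by simp
  finally have "supp_cone C g e = (u \<Zcomp> j) \<Zcomp> p" using e by (simp add: xg cone_star_def)
  then have gu: "supp_cone C g e = u"
    using Comp_assoc[OF u j_hom p(1)] p(2) Idn_right[OF u] by simp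
  have "supp_cone C e = cone_star C (supp_cone C g) v"
    using gu uv(1) e
    by (intro supp_cone_eq cone_star_DSet[OF _ _ sv] cone_at_cone_star[OF _ sv] supp_cone g)
      (simp add: cone_star_def)
  then have "cone_star C (supp_cone C e) u = supp_cone C g"
    using cone_star_comp[OF supp_cone(2)[OF g] v u] cone_star_Idn[OF supp_cone(2)[OF g]] uv(2) by simp
  then have "supp_cone C g = cone_star C (supp_cone C y) h"
    using cone_star_comp[OF supp_cone(2)[OF y] q u] by (simp add: ye hqu)
  then show ?thesis
    using cones_mult[OF supp_cone(2)[OF y]] by (simp add: h_def g_def)
qed

section \<open>The multiplication on objects\<close>

lemma img_supp_cone_Ob: "x \<in> Ob C \<Longrightarrow> y \<in> Ob C \<Longrightarrow> img C (supp_cone C x y) \<in> Ob C"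
  using epi_part_factor[OF supp_cone_hom] hom_Ob(1)[OF incl_hom] by metis

lemma img_supp_cone_incl:
  assumes "x \<in> Ob C" "y \<in> Ob C"
  shows "the_incl C (img C (supp_cone C x y)) x \<in> incl C (img C (supp_cone C x y)) x"
  using epi_part_factor[OF supp_cone_hom[OF assms]] the_incl_eq by metis

lemma img_supp_cone_eq:
  assumes "j \<in> incl C z x"
  shows "img C (supp_cone C x z) = z"
proof -
  have z: "z \<in> Ob C" using hom_Ob(1)[OF incl_hom[OF assms]] .
  show ?thesis
    using img_eq[OF split_epis_Idn[OF z] assms] supp_cone_incl[OF assms] Idn_left[OF incl_hom[OF assms]]
    by simp
qed

text \<open>Evaluate \<open>supp_cone_mult\<close> at e and append the inclusion of the image into
  x. This is the composition law of cone components, from which functoriality in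
  \<open>cc_hom_exists\<close> follows.\<close>

lemma supp_cone_comp:
  assumes x: "x \<in> Ob C" and y: "y \<in> Ob C" and e: "e \<in> Ob C"
  defines "z \<equiv> img C (supp_cone C x y)"
  shows "supp_cone C y e \<Zcomp> supp_cone C x y = supp_cone C z e \<Zcomp> the_incl C z x"
proof -
  let ?h = "epi_part C (supp_cone C x y)"
  obtain j where h: "?h \<in> split_epis C y z" and j: "j \<in> incl C z x" and hj: "supp_cone C x y = ?h \<Zcomp> j"
    using epi_part_factor[OF supp_cone_hom[OF x y]] unfolding z_def by metis
  have "supp_cone C z = cone_star C (supp_cone C y) ?h"
    using supp_cone_mult[OF x y] cones_mult[OF supp_cone(2)[OF y]] by (simp add: z_def)
  then have "supp_cone C z e = supp_cone C y e \<Zcomp> ?h" using e by (simp add: cone_star_def)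
  then show ?thesis
    using Comp_assoc[OF supp_cone_hom[OF y e] split_epis_hom[OF h] incl_hom[OF j]] hj the_incl_eq[OF j]
    by simp
qed

text \<open>Associativity is pulled back from the semigroup of cones, since the assignment of
  \<open>supp_cone\<close> to objects is injective and reverses products. Idempotency says that an
  identity is its own image. For the regular law, a product z of x and y is a subobject of x; its
  inclusion is a section of the component of the cone of z at x, so that component has image
  z.\<close>

lemma left_regular_band_rband: "left_regular_band (rband C)"
proof -
  have assoc: "img C (supp_cone C (img C (supp_cone C x y)) z) = img C (supp_cone C x (img C (supp_cone C y z)))"
    if "x \<in> Ob C" "y \<in> Ob C" "z \<in> Ob C" for x y z
  proof (rule supp_cone_inj)
    have "supp_cone C (img C (supp_cone C (img C (supp_cone C x y)) z))
        = supp_cone C z \<cdot>\<^bsub>cones C\<^esub> (supp_cone C y \<cdot>\<^bsub>cones C\<^esub> supp_cone C x)"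
      using that by (simp add: supp_cone_mult img_supp_cone_Ob)
    also have "\<dots> = (supp_cone C z \<cdot>\<^bsub>cones C\<^esub> supp_cone C y) \<cdot>\<^bsub>cones C\<^esub> supp_cone C x"
      using semigroup_cones supp_cone_elems that unfolding semigroup_on_def by simp
    also have "\<dots> = supp_cone C (img C (supp_cone C x (img C (supp_cone C y z))))"
      using that by (simp add: supp_cone_mult img_supp_cone_Ob)
    finally show "supp_cone C (img C (supp_cone C (img C (supp_cone C x y)) z))
        = supp_cone C (img C (supp_cone C x (img C (supp_cone C y z))))" .
  qed (use that img_supp_cone_Ob in auto)
  have idem: "img C (supp_cone C x x) = x" if "x \<in> Ob C" for x
    using img_supp_cone_eq[OF incl_Idn[OF that]] .
  have regular: "img C (supp_cone C z x) = z" if j: "j \<in> incl C z x" for j z x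
  proof -
    note zx = hom_Ob[OF incl_hom[OF j]]
    have "j \<Zcomp> supp_cone C z x = Idn C z"
      using cone_at_incl[OF supp_cone(2) j] supp_cone(3) zx by simp
    then show ?thesis
      using epi_part_split_epi(2)[OF iso_split_epi[OF supp_cone_hom incl_hom[OF j]]] zx by simp
  qed
  show ?thesis
    unfolding left_regular_band_def semigroup_on_def
    using img_supp_cone_Ob assoc idem regular[OF img_supp_cone_incl] by simp
qed

lemma supp_cones_mult:
  "x \<in> Ob C \<Longrightarrow> y \<in> Ob C \<Longrightarrow>
    supp_cone C y \<cdot>\<^bsub>cones C\<^esub> supp_cone C x = supp_cone C x \<longleftrightarrow> x \<cdot>\<^bsub>rband C\<^esub> y = x"
  using supp_cone_mult[of x y] supp_cone_inj[OF img_supp_cone_Ob, of x y x] by auto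

lemma R_le_supp_class:
  assumes "x \<in> Ob C" "y \<in> Ob C"
  shows "R_le (cones C) (supp_class C x) (supp_class C y) \<longleftrightarrow> x \<cdot>\<^bsub>rband C\<^esub> y = x"
  unfolding supp_class_def supp_cones_mult[OF assms, symmetric]
  using assms supp_cone_elems supp_cone_idem
  by (intro R_le_class_idempotents semigroup_cones) auto

text \<open>The reversal of products turns Green's relation R on the cones into the relation L on
  the object band. The resulting equations are preserved by homomorphisms, which is what makes a
  class map induced by an object map well defined.\<close>

lemma supp_class_eq_iff:
  assumes "x \<in> Ob C" "y \<in> Ob C"
  shows "supp_class C x = supp_class C y \<longleftrightarrow> x \<cdot>\<^bsub>rband C\<^esub> y = x \<and> y \<cdot>\<^bsub>rband C\<^esub> x = y"
proof -
  have "supp_class C x = supp_class C y \<longleftrightarrow> (supp_cone C x, supp_cone C y) \<in> green_R (cones C)"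
    unfolding supp_class_def using assms supp_cone_elems by (intro eq_equiv_class_iff[OF equiv_green_R])
  then show ?thesis
    using green_R_iff_idempotents[OF semigroup_cones] supp_cone_elems supp_cone_idem assms
      supp_cones_mult by simp
qed

end


section \<open>The supported category of a left regular band\<close>

text \<open>The candidate for the idempotent cone with vertex a: its component at e stands for left
  translation by \<open>a \<cdot> e\<close>.\<close>

definition band_cone :: "('a \<times> 'a \<times> 'a \<Rightarrow> 'm) \<Rightarrow> 'a sgrp \<Rightarrow> 'a \<Rightarrow> 'a \<Rightarrow> 'm" where
  "band_cone enc B a = (\<lambda>e \<in> elems B. enc (e, a \<cdot>\<^bsub>B\<^esub> e, a))"

text \<open>This is the category of principal left ideals of the opposite band, which is right regular:
  a morphism \<open>enc (e, u, f)\<close> stands for the translation \<open>x \<mapsto> u x\<close> from \<open>e B\<close> to \<open>f B\<close>.\<close>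

definition band_cat :: "('a \<times> 'a \<times> 'a \<Rightarrow> 'm) \<Rightarrow> 'a sgrp \<Rightarrow> ('a, 'm) conn_cat" where
  "band_cat enc B = \<lparr>
     Ob = elems B,
     Mor = {enc (e, u, f) | e u f. e \<in> elems B \<and> u \<in> elems B \<and> f \<in> elems B \<and>
              u \<cdot>\<^bsub>B\<^esub> e = u \<and> f \<cdot>\<^bsub>B\<^esub> u = u},
     Src = (\<lambda>m. fst (inv enc m)),
     Tgt = (\<lambda>m. snd (snd (inv enc m))),
     Idn = (\<lambda>e. enc (e, e, e)),
     Comp = (\<lambda>m n. enc (fst (inv enc m), fst (snd (inv enc n)) \<cdot>\<^bsub>B\<^esub> fst (snd (inv enc m)),
                     snd (snd (inv enc n)))),
     Inc = {enc (e, e, f) | e f. e \<in> elems B \<and> f \<in> elems B \<and> f \<cdot>\<^bsub>B\<^esub> e = e},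
     DSet = (\<lambda>a. band_cone enc B ` {b \<in> elems B. a \<cdot>\<^bsub>B\<^esub> b = a \<and> b \<cdot>\<^bsub>B\<^esub> a = b}) ` elems B\<rparr>"

locale band =
  fixes B :: "'a sgrp" (structure) and enc :: "'a \<times> 'a \<times> 'a \<Rightarrow> 'm"
  assumes lrb: "left_regular_band B" and inj_enc: "inj enc"
begin

abbreviation L where "L \<equiv> band_cat enc B"

lemma mult_closed: "x \<in> elems B \<Longrightarrow> y \<in> elems B \<Longrightarrow> x \<cdot> y \<in> elems B"
  and mult_assoc: "x \<in> elems B \<Longrightarrow> y \<in> elems B \<Longrightarrow> z \<in> elems B \<Longrightarrow> (x \<cdot> y) \<cdot> z = x \<cdot> (y \<cdot> z)"
  and mult_idem: "x \<in> elems B \<Longrightarrow> x \<cdot> x = x"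
  using lrb by (simp_all add: left_regular_band_def semigroup_on_def)

lemma mult_regular: "x \<in> elems B \<Longrightarrow> y \<in> elems B \<Longrightarrow> x \<cdot> (y \<cdot> x) = x \<cdot> y"
  using lrb mult_assoc[of x y x] by (simp add: left_regular_band_def)

lemma mult_idem_left: "x \<in> elems B \<Longrightarrow> z \<in> elems B \<Longrightarrow> x \<cdot> (x \<cdot> z) = x \<cdot> z"
  using mult_assoc[of x x z] by (simp add: mult_idem)

lemmas band_simps = mult_closed mult_assoc mult_idem mult_regular mult_idem_left

text \<open>Substituting e = f e on the left, e f = f e f = f e = e by the regular law. So the
  one-sided condition \<open>f \<cdot> e = e\<close> used for inclusions is the natural partial
  order of the band.\<close>

lemma le_commute: "e \<in> elems B \<Longrightarrow> f \<in> elems B \<Longrightarrow> f \<cdot> e = e \<Longrightarrow> e \<cdot> f = e"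
  using mult_assoc[of f e f] mult_regular[of f e] by simp

lemma enc_eq [simp]: "enc x = enc y \<longleftrightarrow> x = y"
  using inj_enc by (rule inj_eq)

lemma inv_enc [simp]: "inv enc (enc x) = x"
  using inj_enc by (rule inv_f_f)

lemma L_simps [simp]:
  "Ob L = elems B"
  "Src L (enc (e, u, f)) = e" "Tgt L (enc (e, u, f)) = f" "Idn L e = enc (e, e, e)"
  "enc (e, u, f) \<Zcomp>\<^bsub>L\<^esub> enc (f', v, g) = enc (e, v \<cdot> u, g)"
  "enc (e, u, f) \<in> Mor L \<longleftrightarrow>
     e \<in> elems B \<and> u \<in> elems B \<and> f \<in> elems B \<and> u \<cdot> e = u \<and> f \<cdot> u = u"
  "enc (e, u, f) \<in> Inc L \<longleftrightarrow> e \<in> elems B \<and> f \<in> elems B \<and> f \<cdot> e = e \<and> u = e"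
  by (auto simp: band_cat_def)

lemma L_MorE:
  assumes "m \<in> Mor L"
  obtains e u f where "m = enc (e, u, f)" "e \<in> elems B" "u \<in> elems B" "f \<in> elems B"
    "u \<cdot> e = u" "f \<cdot> u = u"
  using assms by (auto simp: band_cat_def)

lemma L_IncE:
  assumes "m \<in> Inc L"
  obtains e f where "m = enc (e, e, f)" "e \<in> elems B" "f \<in> elems B" "f \<cdot> e = e"
  using assms by (auto simp: band_cat_def)

lemma L_homE:
  assumes "m \<in> hom L e f"
  obtains u where "m = enc (e, u, f)" "e \<in> elems B" "u \<in> elems B" "f \<in> elems B"
    "u \<cdot> e = u" "f \<cdot> u = u"
  using assms by (auto simp: hom_def elim: L_MorE)

lemma L_hom [simp]: "enc (e, u, f) \<in> hom L e' f' \<longleftrightarrow>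
    e = e' \<and> f = f' \<and> e \<in> elems B \<and> u \<in> elems B \<and> f \<in> elems B \<and> u \<cdot> e = u \<and> f \<cdot> u = u"
  by (auto simp: hom_def)

lemma L_comp_conditions:
  assumes "e \<in> elems B" "u \<in> elems B" "f \<in> elems B" "v \<in> elems B" "g \<in> elems B"
    and "u \<cdot> e = u" "g \<cdot> v = v"
  shows "(v \<cdot> u) \<cdot> e = v \<cdot> u" "g \<cdot> (v \<cdot> u) = v \<cdot> u"
  using assms mult_assoc[of v u e] mult_assoc[of g v u] by simp_all

lemma category_L: "category L"
proof
  fix f g h a b c d
  assume f: "f \<in> hom L a b"
  show "Idn L a \<Zcomp>\<^bsub>L\<^esub> f = f" "f \<Zcomp>\<^bsub>L\<^esub> Idn L b = f"
    using f by (auto elim!: L_homE)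
  assume g: "g \<in> hom L b c"
  show "f \<Zcomp>\<^bsub>L\<^esub> g \<in> hom L a c"
    using f g by (auto elim!: L_homE intro: mult_closed L_comp_conditions)
  assume "h \<in> hom L c d"
  then show "(f \<Zcomp>\<^bsub>L\<^esub> g) \<Zcomp>\<^bsub>L\<^esub> h = f \<Zcomp>\<^bsub>L\<^esub> (g \<Zcomp>\<^bsub>L\<^esub> h)"
    using f g by (auto elim!: L_homE simp: mult_assoc)
next
  fix f assume "f \<in> Mor L"
  then show "Src L f \<in> Ob L" "Tgt L f \<in> Ob L" by (auto elim: L_MorE)
next
  fix a assume "a \<in> Ob L"
  then show "Idn L a \<in> hom L a a" by (simp add: mult_idem)
qed

abbreviation P where "P \<equiv> L\<lparr>Mor := Inc L\<rparr>"

lemma P_hom: "m \<in> hom P a b \<longleftrightarrow> m = enc (a, a, b) \<and> a \<in> elems B \<and> b \<in> elems B \<and> b \<cdot> a = a"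
  by (auto simp: hom_def elim: L_IncE)

lemma category_P: "category P"
proof
  fix f g h a b c d
  assume f: "f \<in> hom P a b"
  show "Idn P a \<Zcomp>\<^bsub>P\<^esub> f = f" "f \<Zcomp>\<^bsub>P\<^esub> Idn P b = f"
    using f unfolding P_hom by (auto simp: mult_idem)
  assume g: "g \<in> hom P b c"
  have ca: "c \<cdot> a = a" if "b \<cdot> a = a" "c \<cdot> b = b" "a \<in> elems B" "b \<in> elems B" "c \<in> elems B"
    using mult_assoc[of c b a] that by simp
  show "f \<Zcomp>\<^bsub>P\<^esub> g \<in> hom P a c"
    using f g ca unfolding P_hom by (auto simp: mult_idem)
  assume "h \<in> hom P c d"
  then show "(f \<Zcomp>\<^bsub>P\<^esub> g) \<Zcomp>\<^bsub>P\<^esub> h = f \<Zcomp>\<^bsub>P\<^esub> (g \<Zcomp>\<^bsub>P\<^esub> h)"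
    using f g ca unfolding P_hom by (auto simp: mult_assoc)
next
  fix f assume "f \<in> Mor P"
  then show "Src P f \<in> Ob P" "Tgt P f \<in> Ob P" by (auto elim: L_IncE)
next
  fix a assume "a \<in> Ob P"
  then show "Idn P a \<in> hom P a a" by (simp add: P_hom mult_idem)
qed

lemma strict_preorder_P: "strict_preorder P"
  unfolding strict_preorder_def
proof (intro conjI allI ballI impI category_P)
  fix a b f g assume "f \<in> hom P a b" "g \<in> hom P a b"
  then show "f = g" by (simp add: P_hom)
next
  fix f assume f: "isomorphism P f"
  then obtain a b where ab: "f = enc (a, a, b)" "a \<in> elems B" "b \<in> elems B" "b \<cdot> a = a"
    unfolding isomorphism_def by (auto elim: L_IncE)
  then have "a \<cdot> b = b" using f by (auto simp: isomorphism_def P_hom)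
  then have "a = b" using le_commute ab by metis
  then show "f = Idn P (Src P f)" using ab by simp
qed

lemma with_subobjects_L: "category_with_subobjects L"
  unfolding category_with_subobjects_def
proof (intro conjI ballI impI category_L strict_preorder_P)
  show "Inc L \<subseteq> Mor L" by (auto elim!: L_IncE simp: mult_idem)
next
  fix f assume f: "f \<in> Inc L"
  then show "monomorphism L f"
    unfolding monomorphism_def by (auto elim!: L_IncE L_homE simp: mult_idem)
next
  fix f g h assume "f \<in> Inc L" "g \<in> Inc L" "h \<in> Mor L" "Tgt L h = Src L g \<and> f = h \<Zcomp>\<^bsub>L\<^esub> g"
  then show "h \<in> Inc L" by (elim L_IncE L_MorE) auto
qed

text \<open>From u e = u it follows that u and e u are L-related: u (e u) = u and (e u) u = e u.
  L-related elements are isomorphic objects, with mutually inverse translations by u and by e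
  u.\<close>

lemma isomorphism_L:
  assumes e: "e \<in> elems B" and u: "u \<in> elems B" and ue: "u \<cdot> e = u"
  shows "isomorphism L (enc (e \<cdot> u, u, u))"
proof (rule category.isoI[OF category_L])
  have "u \<cdot> (e \<cdot> u) = u" using ue mult_assoc[OF u e u] u by (simp add: mult_idem)
  then show "enc (e \<cdot> u, u, u) \<in> hom L (e \<cdot> u) u" "enc (u, e \<cdot> u, e \<cdot> u) \<in> hom L u (e \<cdot> u)"
    "enc (e \<cdot> u, u, u) \<Zcomp>\<^bsub>L\<^esub> enc (u, e \<cdot> u, e \<cdot> u) = Idn L (e \<cdot> u)"
    "enc (u, e \<cdot> u, e \<cdot> u) \<Zcomp>\<^bsub>L\<^esub> enc (e \<cdot> u, u, u) = Idn L u"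
    using e u by (simp_all add: band_simps)
qed

lemma cone_at_band_cone:
  assumes a: "a \<in> elems B"
  shows "cone_at L a (band_cone enc B a)" "band_cone enc B a a = Idn L a"
proof -
  show 1: "band_cone enc B a a = Idn L a" using a by (simp add: band_cone_def mult_idem)
  have "j \<Zcomp>\<^bsub>L\<^esub> band_cone enc B a (Tgt L j) = band_cone enc B a (Src L j)" if "j \<in> Inc L" for j
    using that a by (auto elim!: L_IncE simp: band_cone_def mult_assoc)
  moreover have "band_cone enc B a \<in> (\<Pi>\<^sub>E c \<in> Ob L. hom L c a)"
    using a by (auto simp: band_cone_def band_simps)
  moreover have "isomorphism L (band_cone enc B a a)"
    using isomorphism_Idn[OF category_L] a 1 by simp
  ultimately show "cone_at L a (band_cone enc B a)"
    using a unfolding cone_at_def L_simps(1) by blast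
qed

lemma normal_L: "normal_category L"
  unfolding normal_category_def
proof (intro conjI ballI with_subobjects_L)
  have retraction: "retraction_of L (enc (e, e, f)) (enc (f, e, e))"
    if "e \<in> elems B" "f \<in> elems B" "f \<cdot> e = e" for e f
    using that le_commute by (simp add: retraction_of_def mult_idem)
  show "\<exists>q. retraction_of L j q" if "j \<in> Inc L" for j
    using that retraction by (auto elim!: L_IncE)
  show "\<exists>q u j. normal_factorisation L f q u j" if "f \<in> Mor L" for f
    using that
  proof (rule L_MorE)
    fix e u g assume f: "f = enc (e, u, g)" "e \<in> elems B" "u \<in> elems B" "g \<in> elems B"
      "u \<cdot> e = u" "g \<cdot> u = u"
    \<comment> \<open>The element u lies below g but need not lie below e. Its isomorphic copy e u
      does, which gives the factorisation from e to e u by a retraction, on to u by an isomorphism,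
      and into g by an inclusion.\<close>
    have "e \<cdot> (e \<cdot> u) = e \<cdot> u" using f by (simp add: band_simps)
    then have "retraction_of L (enc (e \<cdot> u, e \<cdot> u, e)) (enc (e, e \<cdot> u, e \<cdot> u))"
      using retraction f by (simp add: mult_closed)
    moreover have "u \<cdot> (u \<cdot> (e \<cdot> u)) = u"
      using mult_assoc[of u e u] f by (simp add: mult_idem)
    ultimately have "normal_factorisation L f (enc (e, e \<cdot> u, e \<cdot> u)) (enc (e \<cdot> u, u, u)) (enc (u, u, g))"
      using f isomorphism_L unfolding normal_factorisation_def by auto
    then show ?thesis by blast
  qed
  show "\<exists>\<mu>. cone_at L c \<mu> \<and> \<mu> c = Idn L c" if "c \<in> Ob L" for c
    using cone_at_band_cone that by auto
qed

sublocale L: normal_cat L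
  by unfold_locales (rule normal_L)

lemma L_incl:
  assumes "u \<in> elems B" "f \<in> elems B" "f \<cdot> u = u"
  shows "enc (u, u, f) \<in> incl L u f"
  using assms by (simp add: incl_def mult_idem)

lemma L_split_epi:
  assumes "e \<in> elems B" "u \<in> elems B" "u \<cdot> e = u"
  shows "enc (e, u, u) \<in> split_epis L e u"
proof (rule L.iso_split_epi)
  have "u \<cdot> (e \<cdot> u) = u" using mult_assoc[of u e u] assms by (simp add: mult_idem)
  then show "enc (e, u, u) \<in> hom L e u" "enc (u, e \<cdot> u, e) \<in> hom L u e"
    "enc (u, e \<cdot> u, e) \<Zcomp>\<^bsub>L\<^esub> enc (e, u, u) = Idn L u"
    using assms by (simp_all add: band_simps)
qed

lemma L_epi_part:
  assumes "e \<in> elems B" "u \<in> elems B" "f \<in> elems B" "u \<cdot> e = u" "f \<cdot> u = u"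
  shows "epi_part L (enc (e, u, f)) = enc (e, u, u)" "img L (enc (e, u, f)) = u"
  using L.epi_part_eq[OF L_split_epi L_incl] L.img_eq[OF L_split_epi L_incl] assms
  by (simp_all add: mult_idem)

section \<open>Band cones and the down-set they generate\<close>

lemma band_cone_mult:
  assumes "a \<in> elems B" "v \<in> elems B" "z \<in> elems B" "v \<cdot> a = v" "z \<cdot> v = v" "\<delta> a = enc (a, v, z)"
  shows "band_cone enc B a \<cdot>\<^bsub>cones L\<^esub> \<delta> = band_cone enc B v"
proof -
  have "v \<cdot> (a \<cdot> e) = v \<cdot> e" if "e \<in> elems B" for e
    using mult_assoc[of v a e] that assms by simp
  then show ?thesis
    unfolding L.cones_mult[OF cone_at_band_cone(1)[OF assms(1)]] assms(6) L_epi_part(1)[OF assms(1-5)]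
    by (auto simp: cone_star_def band_cone_def)
qed

lemma band_cone_mult_band_cone:
  assumes "a \<in> elems B" "b \<in> elems B"
  shows "band_cone enc B a \<cdot>\<^bsub>cones L\<^esub> band_cone enc B b = band_cone enc B (b \<cdot> a)"
  using assms by (intro band_cone_mult[where z = b]) (simp_all add: band_cone_def band_simps)

lemma band_cone_elems: "a \<in> elems B \<Longrightarrow> band_cone enc B a \<in> elems (cones L)"
  using cone_at_band_cone(1) L.elems_cones by blast

lemma band_cone_inj:
  assumes "a \<in> elems B" "b \<in> elems B"
  shows "band_cone enc B a = band_cone enc B b \<longleftrightarrow> a = b"
  using L.cone_at_unique cone_at_band_cone(1) assms by metis

text \<open>The product of a band cone at a with an arbitrary cone \<delta> depends only on the
  middle entry v of the component of \<delta> at a, and it is the band cone at v. So the band cones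
  absorb multiplication on the right, which is what \<open>down_set_L\<close> rests on.\<close>

lemma band_cone_right_ideal:
  assumes "a \<in> elems B" "\<gamma> \<in> principal_right_ideal (cones L) (band_cone enc B a)"
  shows "\<exists>b \<in> elems B. \<gamma> = band_cone enc B b"
proof -
  have "\<exists>b \<in> elems B. band_cone enc B a \<cdot>\<^bsub>cones L\<^esub> \<delta> = band_cone enc B b"
    if \<delta>: "\<delta> \<in> elems (cones L)" for \<delta>
  proof -
    obtain z where "cone_at L z \<delta>" using \<delta> L.elems_cones by blast
    then have "\<delta> a \<in> hom L a z" using L.cone_at_hom assms(1) by simp
    then show ?thesis by (rule L_homE) (use band_cone_mult in blast)
  qed
  then show ?thesis using assms unfolding principal_right_ideal_def by blast
qed

text \<open>A cone R-related to a band cone lies in its right ideal and is therefore a band cone;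
  among band cones, R is the relation L of the band. Hence the sets listed as \<open>DSet\<close> in
  \<open>band_cat\<close> are genuine R-classes.\<close>

lemma band_cone_class:
  assumes a: "a \<in> elems B"
  shows "green_R (cones L) `` {band_cone enc B a}
    = band_cone enc B ` {b \<in> elems B. a \<cdot> b = a \<and> b \<cdot> a = b}"
proof -
  have *: "(band_cone enc B a, band_cone enc B b) \<in> green_R (cones L) \<longleftrightarrow> a \<cdot> b = a \<and> b \<cdot> a = b"
    if b: "b \<in> elems B" for b
    using green_R_iff_idempotents[OF L.semigroup_cones] band_cone_elems a b
    by (simp add: band_cone_mult_band_cone band_cone_inj band_simps)
  have "\<exists>b \<in> elems B. \<gamma> = band_cone enc B b" if "(band_cone enc B a, \<gamma>) \<in> green_R (cones L)" for \<gamma>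
    using band_cone_right_ideal[OF a, of \<gamma>] that by (auto simp: green_R_def principal_right_ideal_def)
  then show ?thesis using * by auto
qed

lemma DSet_L: "DSet L = (\<lambda>a. green_R (cones L) `` {band_cone enc B a}) ` elems B"
  using band_cone_class by (auto simp: band_cat_def intro!: image_cong)

lemma down_set_L: "R_down_set (cones L) (DSet L)"
  unfolding R_down_set_def
proof (intro conjI ballI impI)
  show "DSet L \<subseteq> elems (cones L) // green_R (cones L)"
    unfolding DSet_L using band_cone_elems by (auto intro: quotientI)
next
  fix X Y assume Y: "Y \<in> DSet L" and X: "X \<in> elems (cones L) // green_R (cones L)"
    and le: "R_le (cones L) X Y"
  obtain \<gamma> \<delta> where \<gamma>: "\<gamma> \<in> X" and \<delta>: "\<delta> \<in> Y"
    and ideal: "principal_right_ideal (cones L) \<gamma> \<subseteq> principal_right_ideal (cones L) \<delta>"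
    using le by (auto simp: R_le_def)
  obtain b where b: "b \<in> elems B" "\<delta> = band_cone enc B b"
    using Y \<delta> unfolding DSet_L by (auto simp: band_cone_class)
  have "\<gamma> \<in> principal_right_ideal (cones L) \<gamma>" by (simp add: principal_right_ideal_def)
  then obtain c where c: "c \<in> elems B" "\<gamma> = band_cone enc B c"
    using ideal b band_cone_right_ideal by blast
  obtain \<eta> where \<eta>: "X = green_R (cones L) `` {\<eta>}" using X by (rule quotientE)
  then have "X = green_R (cones L) `` {\<gamma>}"
    using equiv_class_eq[OF equiv_green_R, of \<eta> \<gamma>] \<gamma> by simp
  then show "X \<in> DSet L" using c by (simp add: DSet_L)
qed

text \<open>The members of a class in \<open>DSet L\<close> are band cones, and a band cone is
  determined by its vertex. A class connected to c must therefore contain the band cone at c, which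
  gives unique support.\<close>

lemma connected_to_L:
  assumes X: "X \<in> DSet L" and c: "c \<in> elems B"
  shows "connected_to L c X \<longleftrightarrow> X = green_R (cones L) `` {band_cone enc B c}"
proof
  assume "connected_to L c X"
  then obtain \<gamma> where \<gamma>: "\<gamma> \<in> X" "cone_at L c \<gamma>"
    by (auto simp: connected_to_def idempotent_cone_in_def)
  obtain a where a: "a \<in> elems B" "X = green_R (cones L) `` {band_cone enc B a}"
    using X by (auto simp: DSet_L)
  obtain b where b: "b \<in> elems B" "\<gamma> = band_cone enc B b"
    using \<gamma>(1) a by (auto simp: band_cone_class)
  then have "b = c" using L.cone_at_unique[OF \<gamma>(2)] cone_at_band_cone(1) by blast
  then show "X = green_R (cones L) `` {band_cone enc B c}"
    using equiv_class_eq[OF equiv_green_R, of "band_cone enc B a" "band_cone enc B c"] \<gamma>(1) a b by simp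
next
  assume "X = green_R (cones L) `` {band_cone enc B c}"
  then have "idempotent_cone_in L c X (band_cone enc B c)"
    using cone_at_band_cone[OF c] band_cone_elems[OF c] L.cone_idempotent_iff
    by (simp add: idempotent_cone_in_def green_R_def)
  then show "connected_to L c X" by (auto simp: connected_to_def)
qed

lemma supported_L: "supported_category L"
proof -
  have "\<exists>!X. X \<in> DSet L \<and> connected_to L c X" if c: "c \<in> elems B" for c
  proof (rule ex1I[of _ "green_R (cones L) `` {band_cone enc B c}"])
    have "green_R (cones L) `` {band_cone enc B c} \<in> DSet L" using c by (simp add: DSet_L)
    then show "green_R (cones L) `` {band_cone enc B c} \<in> DSet L \<and>
        connected_to L c (green_R (cones L) `` {band_cone enc B c})"
      using connected_to_L c by blast
  qed (use connected_to_L c in blast)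
  then show ?thesis
    using normal_L down_set_L unfolding supported_category_def connected_category_def L_simps(1)
    by blast
qed

sublocale L: supported_cat L
  by unfold_locales (rule supported_L)

lemma supp_cone_L: "a \<in> elems B \<Longrightarrow> supp_cone L a = band_cone enc B a"
proof (rule L.supp_cone_eq)
  assume a: "a \<in> elems B"
  then have "band_cone enc B a \<in> green_R (cones L) `` {band_cone enc B a}"
    using band_cone_elems by (simp add: green_R_def)
  then show "band_cone enc B a \<in> \<Union>(DSet L)" using a by (auto simp: DSet_L)
qed (rule cone_at_band_cone; assumption)+

lemma DSet_L_supp_class: "DSet L = supp_class L ` elems B"
  unfolding DSet_L supp_class_def using supp_cone_L by (auto intro!: image_cong)

lemma rband_L: "x \<in> elems B \<Longrightarrow> y \<in> elems B \<Longrightarrow> x \<cdot>\<^bsub>rband L\<^esub> y = x \<cdot> y"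
  using L_epi_part(2)[of y "x \<cdot> y" x] by (simp add: supp_cone_L band_cone_def band_simps)

end


section \<open>The categories of left regular bands and of supported categories\<close>

lemma hom_LRB: "m \<in> hom LRB S T \<longleftrightarrow>
    (\<exists>f. m = (S, f, T) \<and> left_regular_band S \<and> left_regular_band T \<and> f \<in> sgrp_homs S T)"
  by (auto simp: hom_def LRB_def)

lemma LRB_simps [simp]:
  "Ob LRB = {S. left_regular_band S}" "Idn LRB S = (S, \<lambda>x \<in> elems S. x, S)"
  "(S, f, T) \<Zcomp>\<^bsub>LRB\<^esub> (T', g, U) = (S, compose (elems S) g f, U)"
  by (simp_all add: LRB_def)

lemma compose_Id_right: "f \<in> A \<rightarrow>\<^sub>E B \<Longrightarrow> compose A f (\<lambda>x \<in> A. x) = f"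
  by (auto simp: compose_def fun_eq_iff PiE_def extensional_def)

lemma compose_Id_left: "f \<in> A \<rightarrow>\<^sub>E B \<Longrightarrow> compose A (\<lambda>x \<in> B. x) f = f"
  by (auto simp: compose_def fun_eq_iff PiE_def extensional_def)

lemma sgrp_homs_id: "semigroup_on S \<Longrightarrow> (\<lambda>x \<in> elems S. x) \<in> sgrp_homs S S"
  by (auto simp: sgrp_homs_def semigroup_on_def)

lemma sgrp_homs_compose:
  assumes "semigroup_on S" "f \<in> sgrp_homs S T" "g \<in> sgrp_homs T U"
  shows "compose (elems S) g f \<in> sgrp_homs S U"
  using assms by (auto simp: sgrp_homs_def semigroup_on_def compose_def PiE_iff)

lemma category_LRB: "category LRB"
proof
  fix f assume "f \<in> Mor LRB"
  then show "Src LRB f \<in> Ob LRB" "Tgt LRB f \<in> Ob LRB" by (auto simp: LRB_def)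
next
  fix S assume "S \<in> Ob LRB"
  then show "Idn LRB S \<in> hom LRB S S"
    using sgrp_homs_id by (auto simp: hom_LRB left_regular_band_def)
next
  fix f g h S T U V
  assume f: "f \<in> hom LRB S T"
  then show "Idn LRB S \<Zcomp>\<^bsub>LRB\<^esub> f = f" "f \<Zcomp>\<^bsub>LRB\<^esub> Idn LRB T = f"
    using compose_Id_left compose_Id_right by (auto simp: hom_LRB sgrp_homs_def)
  assume g: "g \<in> hom LRB T U"
  show "f \<Zcomp>\<^bsub>LRB\<^esub> g \<in> hom LRB S U"
    using f g sgrp_homs_compose by (auto simp: hom_LRB left_regular_band_def)
  assume "h \<in> hom LRB U V"
  then show "(f \<Zcomp>\<^bsub>LRB\<^esub> g) \<Zcomp>\<^bsub>LRB\<^esub> h = f \<Zcomp>\<^bsub>LRB\<^esub> (g \<Zcomp>\<^bsub>LRB\<^esub> h)"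
    using f g by (auto simp: hom_LRB sgrp_homs_def compose_def PiE_iff fun_eq_iff)
qed

section \<open>CC-morphisms between supported categories and the category SC\<close>

lemma functor_Ob: "is_functor C D F \<Longrightarrow> a \<in> Ob C \<Longrightarrow> omap F a \<in> Ob D"
  and functor_hom: "is_functor C D F \<Longrightarrow> f \<in> hom C a b \<Longrightarrow> amap F f \<in> hom D (omap F a) (omap F b)"
  by (simp_all add: is_functor_def)

lemma functor_Comp:
  "is_functor C D F \<Longrightarrow> f \<in> hom C a b \<Longrightarrow> g \<in> hom C b c \<Longrightarrow>
    amap F (f \<Zcomp>\<^bsub>C\<^esub> g) = amap F f \<Zcomp>\<^bsub>D\<^esub> amap F g"
  unfolding is_functor_def by blast

text \<open>When each object is connected to exactly one class, the condition ranging over all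
  connected pairs collapses to one equation for \<open>supp_class\<close> and one for the components
  of \<open>supp_cone\<close>.\<close>

lemma cc_homs_iff:
  assumes C: "supported_category C" and C': "supported_category C'"
  shows "F \<in> cc_homs C C' \<longleftrightarrow>
     is_functor C C' F \<and> amap F ` Inc C \<subseteq> Inc C' \<and>
     omap F \<in> extensional (Ob C) \<and> amap F \<in> extensional (Mor C) \<and>
     dmap F \<in> DSet C \<rightarrow>\<^sub>E DSet C' \<and>
     (\<forall>X \<in> DSet C. \<forall>Y \<in> DSet C.
        R_le (cones C) X Y \<longrightarrow> R_le (cones C') (dmap F X) (dmap F Y)) \<and>
     (\<forall>c \<in> Ob C. dmap F (supp_class C c) = supp_class C' (omap F c) \<and>
        (\<forall>c' \<in> Ob C. amap F (supp_cone C c c') = supp_cone C' (omap F c) (omap F c')))"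
proof -
  interpret C: supported_cat C by unfold_locales fact
  interpret C': supported_cat C' by unfold_locales fact
  have "(\<forall>X \<in> DSet C. connected_to C c X \<longrightarrow> connected_to C' (omap F c) (dmap F X) \<and>
        (\<forall>c' \<in> Ob C. amap F (idem_cone C c X c') = idem_cone C' (omap F c) (dmap F X) (omap F c')))
    \<longleftrightarrow> dmap F (supp_class C c) = supp_class C' (omap F c) \<and>
        (\<forall>c' \<in> Ob C. amap F (supp_cone C c c') = supp_cone C' (omap F c) (omap F c'))"
    (is "?lhs \<longleftrightarrow> ?rhs")
    if F: "is_functor C C' F" and D: "dmap F \<in> DSet C \<rightarrow>\<^sub>E DSet C'" and c: "c \<in> Ob C" for c
  proof -
    have Fc: "omap F c \<in> Ob C'" using F c by (simp add: is_functor_def)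
    have X: "supp_class C c \<in> DSet C" using C.supp_class_DSet[OF c] .
    then have FX: "dmap F (supp_class C c) \<in> DSet C'" using D by blast
    have "?lhs \<longleftrightarrow> connected_to C' (omap F c) (dmap F (supp_class C c)) \<and>
        (\<forall>c' \<in> Ob C. amap F (idem_cone C c (supp_class C c) c')
          = idem_cone C' (omap F c) (dmap F (supp_class C c)) (omap F c'))"
      using X C.connected_to_iff c by auto
    also have "\<dots> \<longleftrightarrow> ?rhs"
      unfolding C'.connected_to_iff[OF FX] C.idem_cone_eq[OF c] using Fc C'.idem_cone_eq[OF Fc] by auto
    finally show ?thesis .
  qed
  then show ?thesis unfolding cc_homs_def mem_Collect_eq by (intro conj_cong refl ball_cong) blast+
qed

definition cc_id :: "('o, 'm) conn_cat \<Rightarrow> ('o, 'm, 'o, 'm) cc_map" where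
  "cc_id C = \<lparr>omap = \<lambda>c \<in> Ob C. c, amap = \<lambda>f \<in> Mor C. f, dmap = \<lambda>X \<in> DSet C. X\<rparr>"

definition cc_comp :: "('o, 'm) conn_cat \<Rightarrow> ('o, 'm, 'p, 'n) cc_map \<Rightarrow> ('p, 'n, 'q, 'r) cc_map
    \<Rightarrow> ('o, 'm, 'q, 'r) cc_map" where
  "cc_comp C F G = \<lparr>omap = compose (Ob C) (omap G) (omap F),
     amap = compose (Mor C) (amap G) (amap F), dmap = compose (DSet C) (dmap G) (dmap F)\<rparr>"

lemma cc_id_hom:
  assumes C: "supported_category C"
  shows "cc_id C \<in> cc_homs C C"
proof -
  interpret C: supported_cat C by unfold_locales fact
  have "is_functor C C (cc_id C)"
    using C.category_axioms unfolding is_functor_def by (auto simp: cc_id_def hom_def C.cat_simps)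
  moreover have "supp_cone C c c' \<in> Mor C" if "c \<in> Ob C" "c' \<in> Ob C" for c c'
    using C.supp_cone_hom[OF that] by (rule hom_Mor)
  moreover have "f \<in> Mor C" if "f \<in> Inc C" for f
    using hom_Mor[OF incl_hom[OF C.Inc_incl[OF that]]] .
  ultimately show ?thesis
    unfolding cc_homs_iff[OF C C] using C.supp_class_DSet by (auto simp: cc_id_def)
qed

lemma cc_comp_hom:
  assumes C: "supported_category C" and C': "supported_category C'" and C'': "supported_category C''"
    and F: "F \<in> cc_homs C C'" and G: "G \<in> cc_homs C' C''"
  shows "cc_comp C F G \<in> cc_homs C C''"
proof -
  interpret C: supported_cat C by unfold_locales fact
  interpret C': supported_cat C' by unfold_locales fact
  note F' = F[unfolded cc_homs_iff[OF C C']] and G' = G[unfolded cc_homs_iff[OF C' C'']]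
  have F_Ob: "omap F c \<in> Ob C'" if "c \<in> Ob C" for c
    using F' that by (simp add: is_functor_def)
  have F_hom: "amap F f \<in> hom C' (omap F a) (omap F b)" if "f \<in> hom C a b" for f a b
    using F' that by (simp add: is_functor_def)
  have F_D: "dmap F X \<in> DSet C'" if "X \<in> DSet C" for X
    using F' that by blast
  have cone_Mor: "supp_cone C c c' \<in> Mor C" if "c \<in> Ob C" "c' \<in> Ob C" for c c'
    using C.supp_cone_hom[OF that] by (rule hom_Mor)
  have Inc_Mor: "f \<in> Mor C" if "f \<in> Inc C" for f
    using hom_Mor[OF incl_hom[OF C.Inc_incl[OF that]]] .
  have func: "is_functor C C'' (cc_comp C F G)"
    unfolding is_functor_def
  proof (intro conjI ballI allI)
    fix a assume a: "a \<in> Ob C"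
    show "omap (cc_comp C F G) a \<in> Ob C''"
      using a F_Ob G' by (simp add: cc_comp_def is_functor_def compose_def)
    show "amap (cc_comp C F G) (Idn C a) = Idn C'' (omap (cc_comp C F G) a)"
      using a F_Ob F' G' C.Idn_simps(1) by (simp add: cc_comp_def is_functor_def compose_def)
  next
    fix a b f assume f: "f \<in> hom C a b"
    show "amap (cc_comp C F G) f \<in> hom C'' (omap (cc_comp C F G) a) (omap (cc_comp C F G) b)"
      using F_hom[OF f] G' hom_Mor[OF f] C.hom_Ob[OF f]
      by (simp add: cc_comp_def is_functor_def compose_def)
  next
    fix a b c f g assume f: "f \<in> hom C a b" and g: "g \<in> hom C b c"
    have "amap F (f \<Zcomp>\<^bsub>C\<^esub> g) = amap F f \<Zcomp>\<^bsub>C'\<^esub> amap F g"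
      using functor_Comp[OF _ f g] F' by blast
    moreover have "amap G (amap F f \<Zcomp>\<^bsub>C'\<^esub> amap F g) = amap G (amap F f) \<Zcomp>\<^bsub>C''\<^esub> amap G (amap F g)"
      using functor_Comp[OF _ F_hom[OF f] F_hom[OF g]] G' by blast
    ultimately show "amap (cc_comp C F G) (f \<Zcomp>\<^bsub>C\<^esub> g)
        = amap (cc_comp C F G) f \<Zcomp>\<^bsub>C''\<^esub> amap (cc_comp C F G) g"
      using hom_Mor[OF f] hom_Mor[OF g] hom_Mor[OF C.Comp_in_hom[OF f g]]
      by (simp add: cc_comp_def compose_def)
  next
    show "category C" by unfold_locales
    show "category C''" using G' by (simp add: is_functor_def)
  qed
  have inc: "amap (cc_comp C F G) ` Inc C \<subseteq> Inc C''"
    using F' G' Inc_Mor by (auto simp: cc_comp_def compose_def)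
  have D: "dmap (cc_comp C F G) \<in> DSet C \<rightarrow>\<^sub>E DSet C''"
    using F_D G' by (auto simp: cc_comp_def compose_def)
  have le: "R_le (cones C'') (dmap (cc_comp C F G) X) (dmap (cc_comp C F G) Y)"
    if "X \<in> DSet C" "Y \<in> DSet C" "R_le (cones C) X Y" for X Y
    using F' G' F_D that by (simp add: cc_comp_def compose_def)
  have cls: "dmap (cc_comp C F G) (supp_class C c) = supp_class C'' (omap (cc_comp C F G) c)"
    if c: "c \<in> Ob C" for c
    using c F' G' F_Ob C.supp_class_DSet by (simp add: cc_comp_def compose_def)
  have cone: "amap (cc_comp C F G) (supp_cone C c c')
      = supp_cone C'' (omap (cc_comp C F G) c) (omap (cc_comp C F G) c')"
    if c: "c \<in> Ob C" "c' \<in> Ob C" for c c'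
    using c F' G' F_Ob cone_Mor by (simp add: cc_comp_def compose_def)
  have ext: "omap (cc_comp C F G) \<in> extensional (Ob C)" "amap (cc_comp C F G) \<in> extensional (Mor C)"
    by (simp_all add: cc_comp_def)
  show ?thesis
    unfolding cc_homs_iff[OF C C''] by (intro conjI ballI impI func inc ext D le cls cone)
qed

lemma hom_SC: "m \<in> hom SC C C' \<longleftrightarrow>
    (\<exists>F. m = (C, F, C') \<and> supported_category C \<and> supported_category C' \<and> F \<in> cc_homs C C')"
  by (auto simp: hom_def SC_def CC_def full_sub_def supported_category_def)

lemma SC_simps [simp]:
  "Ob SC = {C. supported_category C}" "Idn SC C = (C, cc_id C, C)"
  "(C, F, C') \<Zcomp>\<^bsub>SC\<^esub> (C1, G, C'') = (C, cc_comp C F G, C'')"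
  by (simp_all add: SC_def CC_def cc_id_def cc_comp_def)

lemma cc_map_eqI:
  fixes F G :: "('o, 'm, 'p, 'n) cc_map"
  assumes "omap F = omap G" "amap F = amap G" "dmap F = dmap G"
  shows "F = G"
  using assms by (cases F, cases G) simp

lemma cc_homs_PiE:
  assumes "F \<in> cc_homs C C'"
  shows "omap F \<in> Ob C \<rightarrow>\<^sub>E Ob C'" "amap F \<in> Mor C \<rightarrow>\<^sub>E Mor C'" "dmap F \<in> DSet C \<rightarrow>\<^sub>E DSet C'"
proof -
  have func: "is_functor C C' F" using assms by (simp add: cc_homs_def)
  have "amap F f \<in> Mor C'" if "f \<in> Mor C" for f
    using hom_Mor[OF functor_hom[OF func Mor_hom[OF that]]] .
  moreover have "omap F c \<in> Ob C'" if "c \<in> Ob C" for c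
    using functor_Ob[OF func that] .
  ultimately show "omap F \<in> Ob C \<rightarrow>\<^sub>E Ob C'" "amap F \<in> Mor C \<rightarrow>\<^sub>E Mor C'" "dmap F \<in> DSet C \<rightarrow>\<^sub>E DSet C'"
    using assms by (auto simp: cc_homs_def PiE_def)
qed

lemma cc_comp_cc_id:
  assumes "F \<in> cc_homs C C'"
  shows "cc_comp C (cc_id C) F = F" "cc_comp C F (cc_id C') = F"
  using cc_homs_PiE[OF assms]
  by (auto intro!: cc_map_eqI simp: cc_comp_def cc_id_def compose_Id_left compose_Id_right)

lemma cc_comp_assoc:
  assumes "F \<in> cc_homs C C'"
  shows "cc_comp C (cc_comp C F G) H = cc_comp C F (cc_comp C' G H)"
  using cc_homs_PiE[OF assms]
  by (auto intro!: cc_map_eqI simp: cc_comp_def compose_def fun_eq_iff PiE_mem)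

lemma category_SC: "category SC"
proof
  fix f assume "f \<in> Mor SC"
  then show "Src SC f \<in> Ob SC" "Tgt SC f \<in> Ob SC" by (auto simp: SC_def full_sub_def)
next
  fix C assume "C \<in> Ob SC"
  then show "Idn SC C \<in> hom SC C C" using cc_id_hom by (simp add: hom_SC)
next
  fix f g h C C' C'' C'''
  assume f: "f \<in> hom SC C C'"
  then show "Idn SC C \<Zcomp>\<^bsub>SC\<^esub> f = f" "f \<Zcomp>\<^bsub>SC\<^esub> Idn SC C' = f"
    using cc_comp_cc_id by (auto simp: hom_SC)
  assume g: "g \<in> hom SC C' C''"
  show "f \<Zcomp>\<^bsub>SC\<^esub> g \<in> hom SC C C''"
    using f g cc_comp_hom by (auto simp: hom_SC)
  assume "h \<in> hom SC C'' C'''"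
  then show "(f \<Zcomp>\<^bsub>SC\<^esub> g) \<Zcomp>\<^bsub>SC\<^esub> h = f \<Zcomp>\<^bsub>SC\<^esub> (g \<Zcomp>\<^bsub>SC\<^esub> h)"
    using f g cc_comp_assoc by (auto simp: hom_SC)
qed


section \<open>Morphisms from the category of a band to a supported category\<close>

locale band_to_supported = band B enc + C: supported_cat C
  for B :: "'a sgrp" and enc :: "'a \<times> 'a \<times> 'a \<Rightarrow> 'm" and C :: "('o, 'n) conn_cat"
begin

text \<open>A morphism with middle entry u splits as the component of the cone at u, because u e =
  u, followed by an inclusion; F preserves both, which gives the formula for \<open>amap\<close>.
  Applied to the component of the cone at x at y, whose image is x y, preservation of split
  epimorphisms and inclusions shows that F preserves images, hence products.\<close>

lemma cc_hom_properties:
  assumes F: "F \<in> cc_homs L C"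
  shows "omap F \<in> sgrp_homs B (rband C)"
    and "enc (e, u, f) \<in> Mor L \<Longrightarrow> amap F (enc (e, u, f)) =
      supp_cone C (omap F u) (omap F e) \<Zcomp>\<^bsub>C\<^esub> the_incl C (omap F u) (omap F f)"
    and "a \<in> elems B \<Longrightarrow> dmap F (supp_class L a) = supp_class C (omap F a)"
proof -
  note F' = F[unfolded cc_homs_iff[OF supported_L C.supported]]
  have func: "is_functor L C F" using F' by simp
  have Ob: "omap F x \<in> Ob C" if "x \<in> elems B" for x
    using func that by (simp add: is_functor_def)
  have hom: "amap F m \<in> hom C (omap F x) (omap F y)" if "m \<in> hom L x y" for m x y
    using func that by (simp add: is_functor_def)
  have split: "amap F m \<in> split_epis C (omap F x) (omap F y)" if m: "m \<in> split_epis L x y" for m x y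
  proof -
    obtain s where s: "s \<in> hom L y x" "s \<Zcomp>\<^bsub>L\<^esub> m = Idn L y" using m by (auto simp: split_epis_def)
    have "amap F s \<Zcomp>\<^bsub>C\<^esub> amap F m = amap F (s \<Zcomp>\<^bsub>L\<^esub> m)"
      using functor_Comp[OF func s(1) split_epis_hom[OF m]] by simp
    also have "\<dots> = Idn C (omap F y)"
      using func L.hom_Ob(1)[OF s(1)] s(2) unfolding is_functor_def by simp
    finally show ?thesis using hom s(1) split_epis_hom[OF m] by (auto simp: split_epis_def)
  qed
  have incl: "amap F m \<in> incl C (omap F x) (omap F y)" if "m \<in> incl L x y" for m x y
    using hom that F' by (auto simp: incl_def)
  have cone: "amap F (enc (y, x \<cdot>\<^bsub>B\<^esub> y, x)) = supp_cone C (omap F x) (omap F y)"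
    if "x \<in> elems B" "y \<in> elems B" for x y
  proof -
    have "amap F (supp_cone L x y) = supp_cone C (omap F x) (omap F y)" using F' that by simp
    then show ?thesis using supp_cone_L[OF that(1)] that(2) by (simp add: band_cone_def)
  qed
  have factor: "amap F (enc (e, u, f)) = amap F (enc (e, u, u)) \<Zcomp>\<^bsub>C\<^esub> amap F (enc (u, u, f))"
    if "enc (e, u, f) \<in> Mor L" for e u f
  proof -
    have "enc (e, u, u) \<in> hom L e u" "enc (u, u, f) \<in> hom L u f" using that by (simp_all add: mult_idem)
    moreover have "enc (e, u, u) \<Zcomp>\<^bsub>L\<^esub> enc (u, u, f) = enc (e, u, f)" using that by (simp add: mult_idem)
    ultimately show ?thesis using functor_Comp[OF func] by metis
  qed
  show "omap F \<in> sgrp_homs B (rband C)"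
    unfolding sgrp_homs_def
  proof (intro CollectI conjI ballI)
    show "omap F \<in> elems B \<rightarrow>\<^sub>E elems (rband C)" using Ob F' by (auto simp: PiE_def)
    fix x y assume xy: "x \<in> elems B" "y \<in> elems B"
    then have "enc (y, x \<cdot>\<^bsub>B\<^esub> y, x) \<in> Mor L" by (simp add: band_simps)
    moreover have "enc (y, x \<cdot>\<^bsub>B\<^esub> y, x \<cdot>\<^bsub>B\<^esub> y) \<in> split_epis L y (x \<cdot>\<^bsub>B\<^esub> y)"
      using xy by (intro L_split_epi) (simp_all add: band_simps)
    moreover have "enc (x \<cdot>\<^bsub>B\<^esub> y, x \<cdot>\<^bsub>B\<^esub> y, x) \<in> incl L (x \<cdot>\<^bsub>B\<^esub> y) x"
      using xy by (intro L_incl) (simp_all add: band_simps)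
    ultimately have "img C (amap F (enc (y, x \<cdot>\<^bsub>B\<^esub> y, x))) = omap F (x \<cdot>\<^bsub>B\<^esub> y)"
      using C.img_eq[OF split incl] factor by simp
    then show "omap F (x \<cdot>\<^bsub>B\<^esub> y) = omap F x \<cdot>\<^bsub>rband C\<^esub> omap F y"
      using cone xy by simp
  qed
  show "amap F (enc (e, u, f)) = supp_cone C (omap F u) (omap F e) \<Zcomp>\<^bsub>C\<^esub> the_incl C (omap F u) (omap F f)"
    if m: "enc (e, u, f) \<in> Mor L"
  proof -
    have "amap F (enc (e, u, u)) = supp_cone C (omap F u) (omap F e)"
      using cone[of u e] m by simp
    moreover have "enc (u, u, f) \<in> incl L u f" using m by (intro L_incl) simp_all
    then have "the_incl C (omap F u) (omap F f) = amap F (enc (u, u, f))"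
      using C.the_incl_eq incl by blast
    ultimately show ?thesis using factor[OF m] by simp
  qed
  show "dmap F (supp_class L a) = supp_class C (omap F a)" if "a \<in> elems B"
    using F' that by simp
qed

lemma cc_hom_eqI:
  assumes F: "F \<in> cc_homs L C" and G: "G \<in> cc_homs L C" and eq: "omap F = omap G"
  shows "F = G"
proof (rule cc_map_eqI[OF eq])
  note F' = F[unfolded cc_homs_def] and G' = G[unfolded cc_homs_def]
  show "amap F = amap G"
  proof (rule extensionalityI[of _ "Mor L"])
    fix m assume "m \<in> Mor L"
    then show "amap F m = amap G m"
      using cc_hom_properties(2)[OF F] cc_hom_properties(2)[OF G] eq by (metis L_MorE)
  qed (use F' G' in auto)
  show "dmap F = dmap G"
  proof (rule extensionalityI[of _ "DSet L"])
    fix X assume "X \<in> DSet L"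
    then show "dmap F X = dmap G X"
      using cc_hom_properties(3)[OF F] cc_hom_properties(3)[OF G] eq by (auto simp: DSet_L_supp_class)
  qed (use F' G' in \<open>auto simp: PiE_def\<close>)
qed

text \<open>A homomorphism preserves the equation \<open>f \<cdot> u = u\<close>, so the inclusions
  required by the formula in \<open>cc_hom_properties\<close> exist in C. It likewise preserves the
  equations that describe the order and equality of classes, so everything reduces to the
  composition law.\<close>

lemma cc_hom_exists:
  assumes h: "h \<in> sgrp_homs B (rband C)"
  shows "\<exists>F \<in> cc_homs L C. omap F = h"
proof -
  have h_Ob: "h x \<in> Ob C" if "x \<in> elems B" for x
    using h that by (auto simp: sgrp_homs_def)
  have h_ext: "h \<in> extensional (elems B)" using h by (auto simp: sgrp_homs_def PiE_def)
  have h_mult: "h (x \<cdot>\<^bsub>B\<^esub> y) = img C (supp_cone C (h x) (h y))" if "x \<in> elems B" "y \<in> elems B" for x y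
    using h that by (simp add: sgrp_homs_def)
  have h_incl: "the_incl C (h x) (h y) \<in> incl C (h x) (h y)"
    if "x \<in> elems B" "y \<in> elems B" "y \<cdot>\<^bsub>B\<^esub> x = x" for x y
    using C.img_supp_cone_incl[OF h_Ob h_Ob, OF that(2,1)] h_mult[OF that(2,1)] that(3) by simp
  \<comment> \<open>The value of \<open>amap\<close> on each morphism is the only one possible. A
    class in \<open>DSet L\<close> does not determine its representative, so \<open>inv_into\<close>
    selects one; the restrictions give the extensional values outside the domains.\<close>
  define F where "F = \<lparr>omap = h,
    amap = (\<lambda>m \<in> Mor L. case inv enc m of (e, u, f) \<Rightarrow>
      supp_cone C (h u) (h e) \<Zcomp>\<^bsub>C\<^esub> the_incl C (h u) (h f)),
    dmap = (\<lambda>X \<in> DSet L. supp_class C (h (inv_into (elems B) (supp_class L) X)))\<rparr>"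
  have F_omap: "omap F = h" by (simp add: F_def)
  have F_amap: "amap F (enc (e, u, f)) = supp_cone C (h u) (h e) \<Zcomp>\<^bsub>C\<^esub> the_incl C (h u) (h f)"
    if "enc (e, u, f) \<in> Mor L" for e u f
    using that by (simp add: F_def)
  \<comment> \<open>Another representative b of the class of a is L-related to a, so
    \<open>h b\<close> and \<open>h a\<close> are L-related and determine the same class in
    C.\<close>
  have F_dmap: "dmap F (supp_class L a) = supp_class C (h a)" if a: "a \<in> elems B" for a
  proof -
    define b where "b = inv_into (elems B) (supp_class L) (supp_class L a)"
    have b: "b \<in> elems B" "supp_class L b = supp_class L a"
      using a by (simp_all add: b_def inv_into_into f_inv_into_f)
    then have "b \<cdot>\<^bsub>B\<^esub> a = b" "a \<cdot>\<^bsub>B\<^esub> b = a"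
      using L.supp_class_eq_iff[of b a] rband_L a unfolding L_simps(1) by simp_all
    then have "supp_class C (h b) = supp_class C (h a)"
      using C.supp_class_eq_iff h_mult[of a b] h_mult[of b a] h_Ob a b(1) by simp
    then show ?thesis using a by (simp add: F_def b_def DSet_L_supp_class)
  qed
  have F_hom: "amap F m \<in> hom C (h e) (h f)" if "m \<in> hom L e f" for m e f
    using that
  proof (rule L_homE)
    fix u assume m: "m = enc (e, u, f)" "e \<in> elems B" "u \<in> elems B" "f \<in> elems B"
      "u \<cdot>\<^bsub>B\<^esub> e = u" "f \<cdot>\<^bsub>B\<^esub> u = u"
    then show ?thesis
      using C.Comp_in_hom[OF C.supp_cone_hom[OF h_Ob h_Ob] incl_hom[OF h_incl]] F_amap by simp
  qed
  have F_Idn: "amap F (Idn L e) = Idn C (h e)" if e: "e \<in> elems B" for e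
  proof -
    have "the_incl C (h e) (h e) = Idn C (h e)" using C.the_incl_eq C.incl_Idn h_Ob e by blast
    then show ?thesis
      using e F_amap C.supp_cone(3)[OF h_Ob[OF e]] C.Idn_left[OF C.Idn_in_hom[OF h_Ob[OF e]]]
      by (simp add: mult_idem)
  qed
  have F_comp: "amap F (m \<Zcomp>\<^bsub>L\<^esub> n) = amap F m \<Zcomp>\<^bsub>C\<^esub> amap F n"
    if m: "m \<in> hom L e f" and n: "n \<in> hom L f g" for m n e f g
    using m
  proof (rule L_homE)
    fix u assume u: "m = enc (e, u, f)" "e \<in> elems B" "u \<in> elems B" "f \<in> elems B"
      "u \<cdot>\<^bsub>B\<^esub> e = u" "f \<cdot>\<^bsub>B\<^esub> u = u"
    from n show ?thesis
    proof (rule L_homE)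
      fix v assume v: "n = enc (f, v, g)" "v \<in> elems B" "g \<in> elems B"
        "v \<cdot>\<^bsub>B\<^esub> f = v" "g \<cdot>\<^bsub>B\<^esub> v = v"
      define w where "w = v \<cdot>\<^bsub>B\<^esub> u"
      have w: "w \<in> elems B" "v \<cdot>\<^bsub>B\<^esub> w = w" using u v by (simp_all add: w_def band_simps)
      have mn: "enc (e, w, g) \<in> Mor L" "m \<Zcomp>\<^bsub>L\<^esub> n = enc (e, w, g)"
        using L.Comp_in_hom[OF m n] u v by (simp_all add: w_def hom_def)
      note j = h_incl[OF u(3,4,6)] and k = h_incl[OF v(2,3,5)] and l = h_incl[OF w(1) v(2) w(2)]
      note eu = C.supp_cone_hom[OF h_Ob[OF u(3)] h_Ob[OF u(2)]]
      note ev = C.supp_cone_hom[OF h_Ob[OF v(2)] h_Ob[OF u(4)]]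
      note ew = C.supp_cone_hom[OF h_Ob[OF w(1)] h_Ob[OF u(2)]]
      note uv = C.supp_cone_hom[OF h_Ob[OF v(2)] h_Ob[OF u(3)]]
      have lk: "the_incl C (h w) (h v) \<Zcomp>\<^bsub>C\<^esub> the_incl C (h v) (h g) = the_incl C (h w) (h g)"
        using C.the_incl_eq[OF C.incl_comp[OF l k]] by simp
      have "amap F m \<Zcomp>\<^bsub>C\<^esub> amap F n
          = (supp_cone C (h u) (h e) \<Zcomp>\<^bsub>C\<^esub> the_incl C (h u) (h f))
            \<Zcomp>\<^bsub>C\<^esub> (supp_cone C (h v) (h f) \<Zcomp>\<^bsub>C\<^esub> the_incl C (h v) (h g))"
        using F_amap u v by simp
      also have "\<dots> = (supp_cone C (h u) (h e) \<Zcomp>\<^bsub>C\<^esub> (the_incl C (h u) (h f) \<Zcomp>\<^bsub>C\<^esub> supp_cone C (h v) (h f)))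
            \<Zcomp>\<^bsub>C\<^esub> the_incl C (h v) (h g)"
        using eu ev incl_hom[OF j] incl_hom[OF k] by (simp add: hom_def C.cat_simps)
      \<comment> \<open>Naturality of the cone at \<open>h v\<close> removes the detour through
        \<open>h f\<close>. What remains is a composite of two cone components, which
        \<open>supp_cone_comp\<close> rewrites through the image w = v u, since h preserves this
        product.\<close>
      also have "the_incl C (h u) (h f) \<Zcomp>\<^bsub>C\<^esub> supp_cone C (h v) (h f) = supp_cone C (h v) (h u)"
        using C.cone_at_incl[OF C.supp_cone(2)[OF h_Ob[OF v(2)]] j] .
      also have "supp_cone C (h u) (h e) \<Zcomp>\<^bsub>C\<^esub> supp_cone C (h v) (h u)
          = supp_cone C (h w) (h e) \<Zcomp>\<^bsub>C\<^esub> the_incl C (h w) (h v)"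
        using C.supp_cone_comp[OF h_Ob h_Ob h_Ob, OF v(2) u(3,2)] h_mult[OF v(2) u(3)]
        by (simp add: w_def)
      also have "\<dots> \<Zcomp>\<^bsub>C\<^esub> the_incl C (h v) (h g) = supp_cone C (h w) (h e) \<Zcomp>\<^bsub>C\<^esub> the_incl C (h w) (h g)"
        using C.Comp_assoc[OF ew incl_hom[OF l] incl_hom[OF k]] lk by simp
      finally show ?thesis using F_amap[OF mn(1)] mn(2) by simp
    qed
  qed
  have F_functor: "is_functor L C F"
    unfolding is_functor_def F_omap
    using F_hom F_Idn F_comp h_Ob L.category_axioms C.category_axioms by simp
  have "amap F m \<in> Inc C" if "m \<in> Inc L" for m
    using that
  proof (rule L_IncE)
    fix e f assume m: "m = enc (e, e, f)" "e \<in> elems B" "f \<in> elems B" "f \<cdot>\<^bsub>B\<^esub> e = e"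
    then have "amap F m = the_incl C (h e) (h f)"
      using F_amap[of e e f] C.supp_cone(3)[OF h_Ob[OF m(2)]] C.Idn_left[OF incl_hom[OF h_incl[OF m(2-4)]]]
      by (simp add: mult_idem)
    then show ?thesis using h_incl[OF m(2-4)] by (simp add: incl_def)
  qed
  moreover have "omap F \<in> extensional (Ob L)" "amap F \<in> extensional (Mor L)"
    using h_ext by (simp_all add: F_def)
  moreover have "dmap F \<in> DSet L \<rightarrow>\<^sub>E DSet C"
  proof (rule PiE_I)
    fix X assume "X \<in> DSet L"
    then show "dmap F X \<in> DSet C"
      using F_dmap C.supp_class_DSet h_Ob by (auto simp: DSet_L_supp_class)
  qed (simp add: F_def)
  moreover have "R_le (cones C) (dmap F X) (dmap F Y)"
    if XY: "X \<in> DSet L" "Y \<in> DSet L" and le: "R_le (cones L) X Y" for X Y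
  proof -
    obtain a b where ab: "a \<in> elems B" "X = supp_class L a" "b \<in> elems B" "Y = supp_class L b"
      using XY by (auto simp: DSet_L_supp_class)
    then have "a \<cdot>\<^bsub>B\<^esub> b = a" using le L.R_le_supp_class[of a b] rband_L unfolding L_simps(1) by simp
    then show ?thesis
      using ab F_dmap C.R_le_supp_class[OF h_Ob h_Ob] h_mult[OF ab(1,3)] by simp
  qed
  moreover have "amap F (supp_cone L c c') = supp_cone C (omap F c) (omap F c')"
    if c: "c \<in> elems B" "c' \<in> elems B" for c c'
  proof -
    let ?w = "c \<cdot>\<^bsub>B\<^esub> c'"
    have "supp_cone L c c' = enc (c', ?w, c)" using c by (simp add: supp_cone_L band_cone_def)
    moreover have "enc (c', ?w, c) \<in> Mor L" using c by (simp add: band_simps)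
    ultimately have "amap F (supp_cone L c c') = supp_cone C (h ?w) (h c') \<Zcomp>\<^bsub>C\<^esub> the_incl C (h ?w) (h c)"
      using F_amap by simp
    \<comment> \<open>The composition law is read backwards with e equal to the middle object, so
      that one of the two components is an identity.\<close>
    also have "\<dots> = supp_cone C (h c') (h c') \<Zcomp>\<^bsub>C\<^esub> supp_cone C (h c) (h c')"
      using C.supp_cone_comp[OF h_Ob h_Ob h_Ob, OF c c(2)] h_mult[OF c] by simp
    also have "\<dots> = supp_cone C (h c) (h c')"
      using C.supp_cone(3) C.Idn_left[OF C.supp_cone_hom] h_Ob c by simp
    finally show ?thesis by (simp add: F_omap)
  qed
  ultimately have "F \<in> cc_homs L C"
    unfolding cc_homs_iff[OF supported_L C.supported] using F_functor F_dmap F_omap by auto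
  then show ?thesis using F_omap by blast
qed

lemma cc_hom_ex1: "h \<in> sgrp_homs B (rband C) \<Longrightarrow> \<exists>!F. F \<in> cc_homs L C \<and> omap F = h"
  using cc_hom_exists cc_hom_eqI by blast

end

section \<open>The embedding of LRB into SC and its couniversal arrows\<close>

lemma (in band) sgrp_homs_rband_L: "sgrp_homs A (rband L) = sgrp_homs A B"
  by (auto simp: sgrp_homs_def rband_L PiE_iff simp del: L.rband_simps(2))

definition band_functor ::
    "('u \<times> 'u \<times> 'u \<Rightarrow> 'u) \<Rightarrow> ('u sgrp, 'u sgrp \<times> ('u \<Rightarrow> 'u) \<times> 'u sgrp, ('u, 'u) conn_cat,
      ('u, 'u) conn_cat \<times> ('u, 'u, 'u, 'u) cc_map \<times> ('u, 'u) conn_cat) funct" where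
  "band_functor enc = \<lparr>omap = band_cat enc,
     amap = (\<lambda>(S, f, T). (band_cat enc S,
       THE F. F \<in> cc_homs (band_cat enc S) (band_cat enc T) \<and> omap F = f, band_cat enc T))\<rparr>"

text \<open>Full faithfulness is the case of \<open>cc_hom_ex1\<close> in which the target is itself
  the category of a band. The object band of that category and the given band agree on their
  elements, though perhaps not as records, so hom sets are compared instead of bands.\<close>

lemma band_cat_ex1:
  assumes "inj enc" "left_regular_band S" "left_regular_band T" "f \<in> sgrp_homs S T"
  shows "\<exists>!F. F \<in> cc_homs (band_cat enc S) (band_cat enc T) \<and> omap F = f"
proof -
  interpret T: band T enc using assms by unfold_locales
  interpret band_to_supported S enc "band_cat enc T" using assms by unfold_locales
  show ?thesis using cc_hom_ex1 assms(4) T.sgrp_homs_rband_L by blast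
qed

lemma band_cat_omap:
  assumes "inj enc" "left_regular_band S" "left_regular_band T"
    and "F \<in> cc_homs (band_cat enc S) (band_cat enc T)"
  shows "omap F \<in> sgrp_homs S T"
proof -
  interpret T: band T enc using assms by unfold_locales
  interpret band_to_supported S enc "band_cat enc T" using assms by unfold_locales
  show ?thesis using cc_hom_properties(1) assms(4) T.sgrp_homs_rband_L by blast
qed

lemma band_functor_eqI:
  assumes "inj enc" "left_regular_band S" "left_regular_band T"
    and F: "F \<in> cc_homs (band_cat enc S) (band_cat enc T)" "omap F = f"
  shows "amap (band_functor enc) (S, f, T) = (band_cat enc S, F, band_cat enc T)"
proof -
  have "f \<in> sgrp_homs S T" using band_cat_omap[OF assms(1-4)] F(2) by simp
  then have "(THE F. F \<in> cc_homs (band_cat enc S) (band_cat enc T) \<and> omap F = f) = F"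
    using F by (intro the1_equality band_cat_ex1 assms) auto
  then show ?thesis by (simp add: band_functor_def)
qed

lemma band_functor_obtain:
  assumes "inj enc" "m \<in> hom LRB S T"
  obtains f F where "m = (S, f, T)" "left_regular_band S" "left_regular_band T" "f \<in> sgrp_homs S T"
    "F \<in> cc_homs (band_cat enc S) (band_cat enc T)" "omap F = f"
    "amap (band_functor enc) m = (band_cat enc S, F, band_cat enc T)"
  using assms(2) band_cat_ex1[OF assms(1)] band_functor_eqI[OF assms(1)] unfolding hom_LRB by metis

lemma supported_band_cat: "inj enc \<Longrightarrow> left_regular_band S \<Longrightarrow> supported_category (band_cat enc S)"
  by (rule band.supported_L) unfold_locales

lemma Ob_band_cat: "Ob (band_cat enc S) = elems S"
  by (simp add: band_cat_def)

lemma is_functor_band_functor: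
  fixes enc :: "'u \<times> 'u \<times> 'u \<Rightarrow> 'u"
  assumes inj: "inj enc"
  shows "is_functor LRB SC (band_functor enc)"
  unfolding is_functor_def
proof (intro conjI ballI allI category_LRB category_SC)
  fix S :: "'u sgrp" assume "S \<in> Ob LRB"
  then have S: "left_regular_band S" by simp
  note sS = supported_band_cat[OF inj S]
  show "omap (band_functor enc) S \<in> Ob SC" using sS by (simp add: band_functor_def)
  show "amap (band_functor enc) (Idn LRB S) = Idn SC (omap (band_functor enc) S)"
    using band_functor_eqI[OF inj S S cc_id_hom[OF sS]]
    by (simp add: cc_id_def Ob_band_cat) (simp add: band_functor_def Ob_band_cat)
next
  fix S T :: "'u sgrp" and m assume "m \<in> hom LRB S T"
  then show "amap (band_functor enc) m \<in> hom SC (omap (band_functor enc) S) (omap (band_functor enc) T)"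
    using supported_band_cat[OF inj] by (elim band_functor_obtain[OF inj]) (auto simp: hom_SC band_functor_def)
next
  fix S T U :: "'u sgrp" and m n assume m: "m \<in> hom LRB S T" and n: "n \<in> hom LRB T U"
  obtain f F where f: "m = (S, f, T)" "left_regular_band S" "left_regular_band T"
    "F \<in> cc_homs (band_cat enc S) (band_cat enc T)" "omap F = f"
    "amap (band_functor enc) m = (band_cat enc S, F, band_cat enc T)"
    using m by (rule band_functor_obtain[OF inj])
  obtain g G where g: "n = (T, g, U)" "left_regular_band U"
    "G \<in> cc_homs (band_cat enc T) (band_cat enc U)" "omap G = g"
    "amap (band_functor enc) n = (band_cat enc T, G, band_cat enc U)"
    using n by (rule band_functor_obtain[OF inj])
  have "cc_comp (band_cat enc S) F G \<in> cc_homs (band_cat enc S) (band_cat enc U)"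
    using cc_comp_hom supported_band_cat[OF inj] f g by blast
  moreover have "omap (cc_comp (band_cat enc S) F G) = compose (elems S) g f"
    using f g by (simp add: cc_comp_def Ob_band_cat)
  ultimately show "amap (band_functor enc) (m \<Zcomp>\<^bsub>LRB\<^esub> n)
      = amap (band_functor enc) m \<Zcomp>\<^bsub>SC\<^esub> amap (band_functor enc) n"
    using band_functor_eqI[OF inj f(2) g(2)] f g by simp
qed

lemma band_functor_fully_faithful:
  assumes inj: "inj enc" and ST: "S \<in> Ob LRB" "T \<in> Ob LRB"
    and g: "g \<in> hom SC (omap (band_functor enc) S) (omap (band_functor enc) T)"
  shows "\<exists>!m. m \<in> hom LRB S T \<and> amap (band_functor enc) m = g"
proof -
  have S: "left_regular_band S" and T: "left_regular_band T" using ST by simp_all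
  obtain G where G: "g = (band_cat enc S, G, band_cat enc T)"
    "G \<in> cc_homs (band_cat enc S) (band_cat enc T)"
    using g by (auto simp: hom_SC band_functor_def)
  show ?thesis
  proof (rule ex1I[of _ "(S, omap G, T)"])
    show "(S, omap G, T) \<in> hom LRB S T \<and> amap (band_functor enc) (S, omap G, T) = g"
      using band_cat_omap[OF inj S T G(2)] band_functor_eqI[OF inj S T G(2)] G(1) S T
      by (simp add: hom_LRB)
    fix m assume "m \<in> hom LRB S T \<and> amap (band_functor enc) m = g"
    then have m: "m \<in> hom LRB S T" "amap (band_functor enc) m = g" by blast+
    show "m = (S, omap G, T)"
      by (rule band_functor_obtain[OF inj m(1)]) (use m(2) G(1) in simp)
  qed
qed

text \<open>The arrow is the CC-morphism E whose object map is the identity of the object band.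
  Composing with E leaves object maps unchanged, so a factor of g through E must have the object map
  of g. That map is a homomorphism into the object band, so exactly one CC-morphism into its
  category has it; its composite with E equals g because the object maps agree.\<close>

lemma band_cat_couniversal:
  assumes inj: "inj enc" and C: "supported_category C"
  shows "\<exists>e \<in> hom SC (band_cat enc (rband C)) C. \<forall>S. left_regular_band S \<longrightarrow>
    (\<forall>g \<in> hom SC (band_cat enc S) C. \<exists>!k. k \<in> hom SC (band_cat enc S) (band_cat enc (rband C)) \<and>
       k \<Zcomp>\<^bsub>SC\<^esub> e = g)"
proof -
  interpret C: supported_cat C by unfold_locales fact
  note R = C.left_regular_band_rband
  interpret R: band_to_supported "rband C" enc C using R inj by unfold_locales
  have "semigroup_on (rband C)" using R by (simp add: left_regular_band_def)
  then obtain E where E: "E \<in> cc_homs R.L C" "omap E = (\<lambda>x \<in> Ob C. x)"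
    using R.cc_hom_exists[OF sgrp_homs_id] by auto
  have omap_comp: "omap (cc_comp (band_cat enc S) K E) = omap K"
    if "left_regular_band S" "K \<in> cc_homs (band_cat enc S) R.L" for S K
    using band_cat_omap[OF inj that(1) R that(2)]
      compose_Id_left[of "omap K" "elems S" "Ob C"]
    by (simp add: cc_comp_def E(2) Ob_band_cat sgrp_homs_def)
  have "\<exists>!k. k \<in> hom SC (band_cat enc S) R.L \<and> k \<Zcomp>\<^bsub>SC\<^esub> (R.L, E, C) = g"
    if S: "left_regular_band S" and g: "g \<in> hom SC (band_cat enc S) C" for S g
  proof -
    interpret S: band_to_supported S enc C using S inj by unfold_locales
    obtain G where G: "g = (S.L, G, C)" "G \<in> cc_homs S.L C" using g by (auto simp: hom_SC)
    obtain K where K: "K \<in> cc_homs S.L R.L" "omap K = omap G"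
      using band_cat_ex1[OF inj S R S.cc_hom_properties(1)[OF G(2)]] by blast
    show ?thesis
    proof (rule ex1I[of _ "(S.L, K, R.L)"])
      have "cc_comp S.L K E \<in> cc_homs S.L C"
        using cc_comp_hom[OF S.supported_L R.supported_L C K(1) E(1)] .
      then have "cc_comp S.L K E = G"
        using S.cc_hom_eqI[OF _ G(2)] omap_comp[OF S K(1)] K(2) by simp
      then show "(S.L, K, R.L) \<in> hom SC S.L R.L \<and> (S.L, K, R.L) \<Zcomp>\<^bsub>SC\<^esub> (R.L, E, C) = g"
        using K(1) G(1) S.supported_L R.supported_L by (simp add: hom_SC)
      fix k assume k: "k \<in> hom SC S.L R.L \<and> k \<Zcomp>\<^bsub>SC\<^esub> (R.L, E, C) = g"
      then obtain K' where K': "k = (S.L, K', R.L)" "K' \<in> cc_homs S.L R.L" by (auto simp: hom_SC)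
      then have "cc_comp S.L K' E = G" using k G(1) by simp
      then have "omap K' = omap K" using omap_comp[OF S K'(2)] K(2) by simp
      then show "k = (S.L, K, R.L)"
        using K' K(1) band_cat_ex1[OF inj S R band_cat_omap[OF inj S R K(1)]] by blast
    qed
  qed
  moreover have "(R.L, E, C) \<in> hom SC R.L C" using E(1) R.supported_L C by (simp add: hom_SC)
  ultimately show ?thesis by blast
qed

text \<open>An infinite set is equipotent with its square; applying such a pairing twice codes
  triples.\<close>

lemma infinite_inj_triples:
  assumes "infinite (UNIV :: 'u set)"
  shows "\<exists>enc :: 'u \<times> 'u \<times> 'u \<Rightarrow> 'u. inj enc"
proof -
  obtain p :: "'u \<times> 'u \<Rightarrow> 'u" where p: "inj p"
    using card_of_Times_same_infinite[OF assms] card_of_ordIso[of "UNIV \<times> UNIV :: ('u \<times> 'u) set" "UNIV :: 'u set"]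
    by (auto simp: bij_betw_def)
  have "inj (\<lambda>(a, b). p (a, p b))" by (auto intro!: injI simp: inj_eq[OF p])
  then show ?thesis by blast
qed

theorem corollary5p6:
  assumes "infinite (UNIV :: 'u set)"
  shows "coreflective_in (LRB :: 'u lrb_cat) (SC :: ('u, 'u) cc_cat)"
proof -
  obtain enc :: "'u \<times> 'u \<times> 'u \<Rightarrow> 'u" where inj: "inj enc"
    using infinite_inj_triples[OF assms] by blast
  let ?A = "omap (band_functor enc) ` Ob LRB"
  have omap: "omap (band_functor enc) = band_cat enc" by (simp add: band_functor_def)
  have "coreflective_subcategory SC ?A"
  proof (rule coreflective_subcategoryI[OF category_SC])
    show "?A \<subseteq> Ob SC" using supported_band_cat[OF inj] by (auto simp: omap)
    fix C :: "('u, 'u) conn_cat" assume "C \<in> Ob SC"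
    then have C: "supported_category C" by simp
    then have "band_cat enc (rband C) \<in> ?A"
      using supported_cat.left_regular_band_rband[OF supported_cat.intro] by (auto simp: omap)
    moreover have "\<exists>e \<in> hom SC (band_cat enc (rband C)) C. \<forall>a \<in> ?A. \<forall>g \<in> hom SC a C.
        \<exists>!k. k \<in> hom SC a (band_cat enc (rband C)) \<and> k \<Zcomp>\<^bsub>SC\<^esub> e = g"
      using band_cat_couniversal[OF inj C] unfolding omap ball_simps LRB_simps by blast
    ultimately show "\<exists>r \<in> ?A. \<exists>e \<in> hom SC r C. \<forall>a \<in> ?A. \<forall>g \<in> hom SC a C.
        \<exists>!k. k \<in> hom SC a r \<and> k \<Zcomp>\<^bsub>SC\<^esub> e = g"
      by (rule bexI[rotated])
  qed
  moreover have "equivalent_cats (LRB :: 'u lrb_cat) (full_sub SC ?A)"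
    by (rule equivalent_full_image[OF is_functor_band_functor[OF inj]])
      (rule band_functor_fully_faithful[OF inj])
  ultimately show ?thesis unfolding coreflective_in_def by blast
qed

end
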